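(* Let $R\in\mathbb{R}$ and let $\mathcal{X}_{(-1,1)}$ denote the characteristic function of $(-1,1)$ and $\delta_{\pm1}$ the Dirac deltas at $x=\pm1$. Consider the linear operator $$L_1 g:=g_{xx}-g_{xx}(0)\,\mathcal{X}_{(-1,1)}-g_x(0)\,[\delta_{-1}-\delta_{1}]-R\,g_{xx}(0)\,[\delta_{-1}+\delta_{1}],$$ acting on functions $g:\mathbb{R}\to\mathbb{C}$ with $g(0)=0$. Call $\lambda\in\mathbb{C}$ an eigenvalue of $L_1$ if there is a nonzero, globally bounded function $g$ on $\mathbb{R}$ with $g(0)=0$ such that $L_1g=\lambda g$ (in the distributional sense). Let $a_0\approx 3.94$ be the root near $3.94$ of $\cos(a)-\sin(a)=e^{-a}$ and let $R_0=(1-e^{a_0}\cos(a_0))/a_0\approx 9.36$. Then every eigenvalue $\lambda$ of $L_1$ satisfies $\Re(\lambda)\le 0$ for all $-1\le R\le R_0$. Moreover, at $R=-1$ a real eigenvalue becomes positive (it equals $0$ at $R=-1$ and is positive for $R<-1$), and at $R=R_0$ a pair of simple, nonzero, complex conjugate eigenvalues crosses the imaginary axis from left to right as $R$ increases.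
   Context: This operator is the linearization around the equilibrium $w^1$ (where $w^1(x)=-x$ for $|x|\le1$, $w^1(x)=1$ for $x<-1$, $w^1(x)=-1$ for $x>1$) of the free-boundary price formation model $w_t=w_{xx}+p'(t)w_x-w_x(0,t)[\delta_{-1}-\delta_1]-Rp'(t)[\phi(w(-1,t))\delta_{-1}-\phi(w(1,t))\delta_1]$, $w(0,t)=0$, $p'(t)=-w_{xx}(0,t)/w_x(0,t)$, with $\phi$ odd and $\phi(\pm1)=\pm1$. The distributional equation $L_1g=\lambda g$ means: $g$ is continuous, $g''-g''(0)\mathcal{X}_{(-1,1)}=\lambda g$ away from $x=\pm1$, and $g'$ has jumps at $\pm1$ dictated by the delta terms. *)

theory Defs
  imports "HOL-Analysis.Analysis"
begin

text \<open>(L_1 - lambda) g = f in the distributional sense, for the parameter R: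
  g is continuous with g(0)=0, twice differentiable away from x = -1, 1 with derivatives g1, g2,
  g2 - g2(0) * chi_(-1,1) - lambda g = f away from -1, 1, and the one-sided limits of g1 at -1, 1
  exist with jumps matching the Dirac delta terms:
  [g'](-1) = g'(0) + R g''(0),  [g'](1) = - g'(0) + R g''(0), where [g'](a) = g'(a+) - g'(a-).\<close>
definition L1_eq :: "real \<Rightarrow> complex \<Rightarrow> (real \<Rightarrow> complex) \<Rightarrow> (real \<Rightarrow> complex) \<Rightarrow> bool" where
  "L1_eq R lam f g \<longleftrightarrow>
     continuous_on UNIV g \<and> g 0 = 0 \<and>
     (\<exists>g1 g2.
        (\<forall>x. x \<noteq> -1 \<and> x \<noteq> 1 \<longrightarrow>
            (g has_vector_derivative g1 x) (at x) \<and> (g1 has_vector_derivative g2 x) (at x)) \<and>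
        (\<forall>x. x \<noteq> -1 \<and> x \<noteq> 1 \<longrightarrow>
            g2 x - (if \<bar>x\<bar> < 1 then g2 0 else 0) - lam * g x = f x) \<and>
        (\<exists>a b c d.
            (g1 \<longlongrightarrow> a) (at_left (-1)) \<and> (g1 \<longlongrightarrow> b) (at_right (-1)) \<and>
            (g1 \<longlongrightarrow> c) (at_left 1) \<and> (g1 \<longlongrightarrow> d) (at_right 1) \<and>
            b - a = g1 0 + complex_of_real R * g2 0 \<and>
            d - c = - g1 0 + complex_of_real R * g2 0))"

definition L1_eigenfun :: "real \<Rightarrow> complex \<Rightarrow> (real \<Rightarrow> complex) \<Rightarrow> bool" where
  "L1_eigenfun R lam g \<longleftrightarrow> L1_eq R lam (\<lambda>_. 0) g \<and> bounded (range g) \<and> g \<noteq> (\<lambda>_. 0)"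

definition L1_eigenvalue :: "real \<Rightarrow> complex \<Rightarrow> bool" where
  "L1_eigenvalue R lam \<longleftrightarrow> (\<exists>g. L1_eigenfun R lam g)"

definition L1_simple_eigenvalue :: "real \<Rightarrow> complex \<Rightarrow> bool" where
  "L1_simple_eigenvalue R lam \<longleftrightarrow> L1_eigenvalue R lam \<and>
     (\<forall>g h. L1_eigenfun R lam g \<and> L1_eigenfun R lam h \<longrightarrow> (\<exists>c. h = (\<lambda>x. c * g x))) \<and>
     (\<forall>g. L1_eigenfun R lam g \<longrightarrow> \<not> (\<exists>h. L1_eq R lam g h \<and> bounded (range h)))"

end

(*
  Write lambda = mu^2 with Re mu > 0.  A bounded solution decays like exp(- mu |x|) outside [-1, 1],
  and inside it is determined by A = g'(0) and B = g''(0).  The two jump conditions then say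
  A (exp mu - 1) = 0 and B (exp mu - 1 + R mu) = 0, so A = 0 and mu is a root of
  exp mu - 1 + R mu, with an even eigenfunction.

  For Re lambda > 0, mu = a + i b lies in the sector |b| < a.  If R <= 0, or if a >= a0, comparing
  the moduli of exp mu and 1 - R mu excludes a root.  If R > 0 and a < a0, a root with b >= 0 has
  sin b < 0, so pi < b < a < a0 < 4; eliminating R gives exp(-a) + a (sin b / b) - cos b = 0, while
  monotonicity bounds the left side below by exp(-a) + sin a - cos a, which is positive before a0.

  The eigenvalue is simple as long as mu is a simple root: the mu-derivative of the eigenfunction
  solves the equation with the eigenfunction as right-hand side, but its jumps are off by the
  derivative of (1 - exp mu) / mu.  At R0 the root is a0 (1 + i), and the inverse function theorem
  continues it in R.
*)
theory Submission
  imports Defs "HOL-Complex_Analysis.Conformal_Mappings"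
begin

section \<open>Roots of the characteristic equation\<close>

text \<open>The hypotheses are the real and imaginary parts of \<open>exp mu = 1 - R mu\<close> for
  \<open>mu = a + i b\<close>, so both sides are its squared modulus.\<close>

lemma char_eq_moduli:
  fixes a b R :: real
  assumes "exp a * cos b = 1 - R * a" "exp a * sin b = - R * b"
  shows "exp (2 * a) = 1 - 2 * (R * a) + R\<^sup>2 * (a\<^sup>2 + b\<^sup>2)"
proof -
  have "exp (2 * a) = (exp a)\<^sup>2 * ((cos b)\<^sup>2 + (sin b)\<^sup>2)"
    by (simp add: exp_double sin_squared_eq)
  also have "\<dots> = (exp a * cos b)\<^sup>2 + (exp a * sin b)\<^sup>2"
    by (simp only: power_mult_distrib distrib_left)
  also have "\<dots> = 1 - 2 * (R * a) + R\<^sup>2 * (a\<^sup>2 + b\<^sup>2)"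
    unfolding assms by (simp add: power2_eq_square algebra_simps)
  finally show ?thesis .
qed

section \<open>Elementary estimates: exp, pi, and trigonometric functions on [pi, 4]\<close>

lemma exp_gt_quadratic:
  fixes x :: real
  assumes "x > 0"
  shows "1 + x + x\<^sup>2 / 2 < exp x"
proof -
  have "exp 0 - 0 - 0\<^sup>2/2 < exp x - x - x\<^sup>2/2"
  proof (rule DERIV_pos_imp_increasing_open[OF assms])
    fix y :: real assume "0 < y"
    then have "exp y - 1 - y > 0"
      using exp_minus_greater[of "-y"] by simp
    moreover have "((\<lambda>x. exp x - x - x\<^sup>2/2) has_real_derivative (exp y - 1 - y)) (at y)"
      by (auto intro!: derivative_eq_intros)
    ultimately show "\<exists>d. ((\<lambda>x. exp x - x - x\<^sup>2/2) has_real_derivative d) (at y) \<and> d > 0"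
      by blast
  qed (auto intro!: continuous_intros)
  then show ?thesis by simp
qed

text \<open>Since cos is nonnegative on [0, pi/2], it suffices that \<open>cos 1.95 < 0\<close>. The
  bound puts \<open>a0\<close> beyond pi, which gives \<open>sin a0 < 0\<close>.\<close>

lemma pi_less_39: "pi < 3.9"
proof -
  obtain t where "cos (1.95::real) = (\<Sum>m<6. (cos_coeff m) * 1.95 ^ m) + (cos (t + 1/2 * real 6 * pi) / (fact 6)) * 1.95 ^ 6"
    using Maclaurin_cos_expansion[of "1.95" 6] by blast
  moreover have "(cos (t + 1/2 * real 6 * pi) / (fact 6)) * 1.95 ^ 6 \<le> (1 / fact 6) * (1.95 ^ 6 :: real)"
    by (intro mult_right_mono divide_right_mono) auto
  \<comment> \<open>Numerically about -0.22: the Taylor sum of degree 4 plus the bound 1.95^6 / 720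
    on the remainder.\<close>
  moreover have "(\<Sum>m<6. (cos_coeff m) * 1.95 ^ m) + (1 / fact 6) * (1.95 ^ 6 :: real) < 0"
    by (simp add: cos_coeff_def lessThan_nat_numeral fact_numeral power_divide)
  ultimately have neg: "cos (1.95::real) < 0" by linarith
  show ?thesis
  proof (rule ccontr)
    assume "\<not> pi < 3.9"
    then have "cos (1.95::real) \<ge> 0" by (intro cos_ge_zero) auto
    with neg show False by simp
  qed
qed

text \<open>The interval [pi, 4] is shorter than 1, hence than pi/3, so shifting by pi reduces the
  first two bounds to [0, pi/3]. They make the functions of the next two lemmas decreasing.\<close>

lemma cos_sin_bounds_above_pi:
  fixes x :: real
  assumes "pi \<le> x" "x \<le> 4"
  shows "cos x \<le> -1/2" "sin x \<le> 0" "x * cos x < sin x"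
proof -
  define t where "t = x - pi"
  have t: "0 \<le> t" "t \<le> 1" using assms pi_gt3 by (auto simp: t_def)
  have x: "x = t + pi" by (simp add: t_def)
  have "cos (pi / 3) \<le> cos t" using t pi_gt3 by (intro cos_monotone_0_pi_le) auto
  then show c: "cos x \<le> -1/2" unfolding x by (simp add: cos_60)
  show "sin x \<le> 0" unfolding x using t pi_gt3 by (simp add: sin_ge_zero)
  have "x * cos x \<le> x * (-1/2)" using c assms pi_gt3 by (intro mult_left_mono) auto
  also have "\<dots> < -1" using assms pi_gt3 by simp
  also have "\<dots> \<le> sin x" by simp
  finally show "x * cos x < sin x" .
qed

text \<open>No term of the derivative is positive on [pi, 4]. The function vanishes at the root
  \<open>a0\<close>, so its decrease makes it positive on [pi, a0).\<close>

lemma sin_cos_exp_antimono: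
  fixes x y :: real
  assumes "pi \<le> x" "x < y" "y \<le> 4"
  shows "exp (- y) + sin y - cos y < exp (- x) + sin x - cos x"
proof (rule DERIV_neg_imp_decreasing[OF assms(2)])
  fix z assume z: "x \<le> z" "z \<le> y"
  have "- exp (- z) + cos z + sin z < 0"
    using cos_sin_bounds_above_pi[of z] z assms exp_gt_zero[of "-z"] by linarith
  then show "\<exists>d. ((\<lambda>x. exp (- x) + sin x - cos x) has_real_derivative d) (at z) \<and> d < 0"
    by (intro exI[of _ "- exp (- z) + cos z + sin z"]) (auto intro!: derivative_eq_intros)
qed

text \<open>The derivative has the sign of \<open>z * cos z - sin z\<close>. This bounds
  \<open>sin b / b\<close> below by \<open>sin a / a\<close> when pi < b < a.\<close>

lemma sinc_antimono:
  fixes x y :: real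
  assumes "pi \<le> x" "x < y" "y \<le> 4"
  shows "sin y / y < sin x / x"
proof (rule DERIV_neg_imp_decreasing[OF assms(2)])
  fix z assume z: "x \<le> z" "z \<le> y"
  have "z > 0" using z assms pi_gt_zero by linarith
  then have "((\<lambda>x. sin x / x) has_real_derivative (z * cos z - sin z) / z\<^sup>2) (at z)"
    by (auto intro!: derivative_eq_intros simp: power2_eq_square)
  moreover have "(z * cos z - sin z) / z\<^sup>2 < 0"
    using cos_sin_bounds_above_pi[of z] z assms \<open>z > 0\<close> by (simp add: divide_neg_pos)
  ultimately show "\<exists>d. ((\<lambda>x. sin x / x) has_real_derivative d) (at z) \<and> d < 0" by blast
qed

text \<open>With \<open>mu = a + i b\<close>, the sector 0 <= b < a is, up to conjugation, the
  region Re mu > 0, Re mu^2 > 0, that is, the unstable half plane for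
  \<open>lambda = mu^2\<close>.\<close>

lemma no_char_root:
  fixes a b R a0 R0 :: real
  assumes a0: "3.9 < a0" "a0 < 4" "cos a0 - sin a0 = exp (- a0)" "R0 = (1 - exp a0 * cos a0) / a0"
    and R: "-1 \<le> R" "R \<le> R0" and ab: "0 \<le> b" "b < a"
    and eq: "exp a * cos b = 1 - R * a" "exp a * sin b = - R * b"
  shows False
proof -
  have "a > 0" using ab by linarith
  have "0 < a\<^sup>2" "b\<^sup>2 < a\<^sup>2" using ab \<open>a > 0\<close> by (auto intro: power_strict_mono)
  note mod = char_eq_moduli[OF eq]
  note E = exp_gt_quadratic[of "2 * a"]
  show False
  proof (cases "R \<le> 0")
    case True
    \<comment> \<open>For -1 <= R <= 0 the squared modulus of \<open>1 - R mu\<close> is at most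
      \<open>1 + 2 a + 2 a^2\<close>, the quadratic Taylor polynomial of exp at
      \<open>2 * a\<close>.\<close>
    have "R\<^sup>2 \<le> 1" using True R by (simp add: abs_square_le_1)
    then have "R\<^sup>2 * (a\<^sup>2 + b\<^sup>2) \<le> 1 * (2 * a\<^sup>2)"
      using \<open>b\<^sup>2 < a\<^sup>2\<close> by (intro mult_mono) auto
    moreover have "- (R * a) \<le> a" using mult_right_mono[of "-1" R a] R \<open>a > 0\<close> by simp
    ultimately show False using mod E \<open>a > 0\<close> by (simp add: power_mult_distrib)
  next
    case False
    then have "R > 0" by simp
    \<comment> \<open>\<open>y0\<close> and \<open>y0'\<close> say that \<open>a0 (1 + i)\<close> is
      a root of the characteristic equation at \<open>R0\<close>.\<close>
    have y0: "exp a0 * cos a0 = 1 - R0 * a0" using a0 by (simp add: field_simps)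
    have "exp a0 * (cos a0 - sin a0) = 1" using a0 by (simp add: exp_minus)
    then have y0': "exp a0 * sin a0 = - R0 * a0" using y0 by (simp add: algebra_simps)
    show False
    proof (cases "a < a0")
      case True
      have "1 < exp a" "0 < R * a" using \<open>R > 0\<close> \<open>a > 0\<close> by simp_all
      moreover have "exp a = 1 - R * a" if "b = 0" using eq(1) that by simp
      ultimately have "b \<noteq> 0" by linarith
      then have "b > 0" using ab by simp
      then have "exp a * sin b < 0" using eq(2) \<open>R > 0\<close> by simp
      then have "sin b < 0" by (simp add: mult_less_0_iff)
      have bpi: "b > pi" using \<open>sin b < 0\<close> ab sin_ge_zero[of b] by (meson linorder_not_less)
      have "sin a / a < sin b / b" using bpi ab True a0 by (intro sinc_antimono) auto
      then have 1: "sin a < a * (sin b / b)" using \<open>a > 0\<close> by (simp add: divide_less_eq mult.commute)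
      \<comment> \<open>Cosine increases on [pi, 2 pi]; the shift by pi moves both points to
        [0, pi].\<close>
      have 2: "cos b \<le> cos a"
        using cos_mono_le_eq[of "a - pi" "b - pi"] bpi ab True a0 pi_gt3 by (simp)
      have 3: "exp (- a0) + sin a0 - cos a0 < exp (- a) + sin a - cos a"
        using bpi ab True a0 by (intro sin_cos_exp_antimono) auto
      \<comment> \<open>Multiplied by a / b, the imaginary part acquires the same R-term as the real
        part, so the difference is free of R.\<close>
      have "exp a * (a * (sin b / b)) = - R * a"
        using eq(2) \<open>b > 0\<close> by (simp add: field_simps)
      then have "exp a * (cos b - a * (sin b / b)) = 1" using eq(1) by (simp add: algebra_simps)
      then have "cos b - a * (sin b / b) = exp (- a)" by (simp add: exp_minus field_simps)
      with 1 2 3 a0(3) show False by linarith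
    next
      case False
      \<comment> \<open>For a >= a0 the target is \<open>1 - 2 R a + 2 (R a)^2 <= exp (2 a)\<close>,
        whose left side is the squared modulus of \<open>1 - R mu\<close> at the sector boundary b =
        a. It is shown first for \<open>R0\<close>, by expanding in \<open>s\<close>, and then for
        smaller R.\<close>
      define s where "s = a - a0"
      have "s \<ge> 0" using False by (simp add: s_def)
      define y where "y = R0 * a0"
      have "R0 > 0" using R \<open>R > 0\<close> by simp
      have "y > 0" unfolding y_def using \<open>R0 > 0\<close> a0(1) by (intro mult_pos_pos) auto
      define K where "K = 1 - 2 * y + 2 * y\<^sup>2"
      have K: "exp (2 * a0) = K"
        using char_eq_moduli[OF y0 y0'] by (simp add: K_def y_def algebra_simps)
      \<comment> \<open>At \<open>R0\<close> the quadratic in \<open>s\<close> is compared with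
        \<open>K * (1 + 2 s + 2 s^2)\<close>: the constant terms agree, \<open>K1\<close> compares
        the coefficients of \<open>s^2\<close>, and \<open>K2\<close> those of
        \<open>s\<close>.\<close>
      have R0y: "3.9 * R0 \<le> y" using a0(1) \<open>R0 > 0\<close> by (simp add: y_def)
      have "(3.9 * R0)\<^sup>2 \<le> y\<^sup>2" using R0y \<open>R0 > 0\<close> by (intro power_mono) auto
      then have "1521 * R0\<^sup>2 \<le> y\<^sup>2 * 100" by (simp add: power_mult_distrib power_divide)
      then have "R0\<^sup>2 \<le> y\<^sup>2" using zero_le_power2[of R0] by linarith
      also have "\<dots> \<le> y\<^sup>2 + (y - 1)\<^sup>2" by simp
      finally have K1: "R0\<^sup>2 \<le> K" by (simp add: K_def power2_eq_square algebra_simps)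
      have K2: "R0 * (2 * y - 1) \<le> K"
      proof (cases "2 * y \<le> 1")
        case True
        then have "R0 * (2 * y - 1) \<le> 0" using \<open>R0 > 0\<close> by (simp add: mult_le_0_iff)
        also have "0 \<le> K" unfolding K[symmetric] by simp
        finally show ?thesis .
      next
        case False
        then have "R0 * (2 * y - 1) \<le> y / 2 * (2 * y - 1)"
          using R0y \<open>y > 0\<close> \<open>R0 > 0\<close> by (intro mult_right_mono) auto
        \<comment> \<open>The difference is
          \<open>y^2 - 3/2 y + 1 = (y - 3/4)^2 + 7/16\<close>.\<close>
        also have "\<dots> \<le> K"
          using zero_le_power2[of "y - 3/4"] by (simp add: K_def power2_eq_square field_simps)
        finally show ?thesis .
      qed
      have "exp (2 * a) = K * exp (2 * s)"
        unfolding K[symmetric] by (simp add: s_def flip: exp_add)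
      also have "\<dots> \<ge> K * (1 + 2 * s + 2 * s\<^sup>2)"
        using exp_lower_Taylor_quadratic[of "2 * s"] \<open>s \<ge> 0\<close> exp_ge_zero[of "2 * a0"]
        by (intro mult_left_mono) (auto simp: K power_mult_distrib)
      also have "K * (1 + 2 * s + 2 * s\<^sup>2) = K + 2 * (K * s) + 2 * (K * s\<^sup>2)" by (simp add: algebra_simps)
      also have "\<dots> \<ge> K + 2 * (R0 * (2 * y - 1) * s) + 2 * (R0\<^sup>2 * s\<^sup>2)"
        using mult_right_mono[OF K2 \<open>s \<ge> 0\<close>] mult_right_mono[OF K1, of "s\<^sup>2"] by simp
      also have "K + 2 * (R0 * (2 * y - 1) * s) + 2 * (R0\<^sup>2 * s\<^sup>2) = 1 - 2 * (R0 * a) + 2 * (R0 * a)\<^sup>2"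
        by (simp add: K_def y_def s_def power2_eq_square algebra_simps)
      finally have top: "1 - 2 * (R0 * a) + 2 * (R0 * a)\<^sup>2 \<le> exp (2 * a)" .
      \<comment> \<open>With t = R a the left side is \<open>1 + 2 t (t - 1)\<close>: at most 1 for
        t in [0, 1], and increasing for t >= 1, where the bound at \<open>R0\<close> takes
        over.\<close>
      have "1 - 2 * (R * a) + 2 * (R * a)\<^sup>2 \<le> exp (2 * a)"
      proof (cases "R * a \<le> 1")
        case True
        have "(R * a) * (R * a - 1) \<le> 0"
          using True \<open>R > 0\<close> \<open>a > 0\<close> by (intro mult_nonneg_nonpos) auto
        then have "1 - 2 * (R * a) + 2 * (R * a)\<^sup>2 \<le> 1" by (simp add: power2_eq_square algebra_simps)
        also have "1 \<le> exp (2 * a)" using \<open>a > 0\<close> by simp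
        finally show ?thesis .
      next
        case False
        have "R * a \<le> R0 * a" using R \<open>a > 0\<close> by simp
        then have "(R * a) * (R * a - 1) \<le> (R0 * a) * (R0 * a - 1)"
          using False R \<open>R0 > 0\<close> \<open>a > 0\<close> by (intro mult_mono) auto
        then show ?thesis using top by (simp add: power2_eq_square algebra_simps)
      qed
      moreover have "R\<^sup>2 * (a\<^sup>2 + b\<^sup>2) < R\<^sup>2 * (2 * a\<^sup>2)"
        using \<open>R > 0\<close> \<open>b\<^sup>2 < a\<^sup>2\<close> by simp
      ultimately show False using mod by (simp add: power_mult_distrib)
    qed
  qed
qed

section \<open>Positive real roots for R < -1\<close>

text \<open>The function \<open>(exp x - 1) / x\<close> has slope at least 1/2 for x > 0, because
  \<open>x exp x - exp x + 1 >= x^2 / 2\<close>. Consequently the root s of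
  \<open>exp s - 1 = r s\<close> is Lipschitz in r with constant 2.\<close>

lemma expm1_slope_lower:
  fixes s t :: real
  assumes "0 < s" "s \<le> t"
  shows "(t - s) / 2 \<le> (exp t - 1) / t - (exp s - 1) / s"
proof -
  have "(exp s - 1) / s - s / 2 \<le> (exp t - 1) / t - t / 2"
  proof (rule DERIV_nonneg_imp_nondecreasing[OF assms(2)])
    fix x assume "s \<le> x" "x \<le> t"
    then have "x > 0" using assms by simp
    have "0 * exp 0 - exp 0 + 1 - 0\<^sup>2 / 2 \<le> x * exp x - exp x + 1 - x\<^sup>2 / 2"
    proof (rule DERIV_nonneg_imp_nondecreasing[of 0 x])
      fix z :: real assume "0 \<le> z"
      then have "z * exp z - z \<ge> 0" using mult_left_mono[of 1 "exp z" z] by simp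
      then show "\<exists>d. ((\<lambda>x. x * exp x - exp x + 1 - x\<^sup>2 / 2) has_real_derivative d) (at z) \<and> 0 \<le> d"
        by (intro exI[of _ "z * exp z - z"]) (auto intro!: derivative_eq_intros)
    qed (use \<open>x > 0\<close> in simp)
    then have "(x * exp x - (exp x - 1)) / x\<^sup>2 - 1 / 2 \<ge> 0"
      using \<open>x > 0\<close> by (simp add: field_simps)
    moreover have "((\<lambda>x. (exp x - 1) / x - x / 2) has_real_derivative
        (x * exp x - (exp x - 1)) / x\<^sup>2 - 1 / 2) (at x)"
      using \<open>x > 0\<close> by (auto intro!: derivative_eq_intros simp: power2_eq_square)
    ultimately show "\<exists>d. ((\<lambda>x. (exp x - 1) / x - x / 2) has_real_derivative d) (at x) \<and> 0 \<le> d"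
      by blast
  qed
  then show ?thesis unfolding diff_divide_distrib by linarith
qed

text \<open>The function \<open>exp s - 1 - r * s\<close> is minimal at \<open>ln r\<close>, where
  it is not positive, and at \<open>2 * r\<close> the quadratic term of exp outweighs
  \<open>r * s\<close>. Starting at \<open>ln r > 0\<close> excludes the trivial root 0.\<close>

lemma expm1_eq_linear_root:
  fixes r :: real
  assumes "1 < r"
  shows "\<exists>s>0. exp s - 1 = r * s"
proof -
  have "ln r > 0" using assms by simp
  have "exp (- ln r) > 1 - ln r"
    using exp_minus_greater[of "ln r"] \<open>ln r > 0\<close> by simp
  then have lo: "exp (ln r) - 1 - r * ln r \<le> 0"
    using assms by (simp add: exp_minus field_simps)
  have hi: "0 \<le> exp (2 * r) - 1 - r * (2 * r)"
    using exp_gt_quadratic[of "2 * r"] assms by (simp add: power2_eq_square)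
  have "\<exists>s. ln r \<le> s \<and> s \<le> 2 * r \<and> exp s - 1 - r * s = 0"
    using lo hi assms ln_bound[of r] by (intro IVT'[of "\<lambda>s. exp s - 1 - r * s"]) (auto intro!: continuous_intros)
  then obtain s where "ln r \<le> s" "exp s - 1 - r * s = 0" by blast
  then show ?thesis using \<open>ln r > 0\<close> by (intro exI[of _ s]) auto
qed

section \<open>Bounded solutions with prescribed jumps\<close>

text \<open>The equation of \<open>L1_eq\<close> with the Cauchy data \<open>A = g'(0)\<close>, \<open>B = g''(0)\<close> and the jumps
  \<open>p\<close>, \<open>q\<close> of \<open>g'\<close> at \<open>-1\<close>, \<open>1\<close> as free parameters; unlike \<open>L1_eq\<close> it does not involve \<open>R\<close>,
  and it is jointly linear in all its data.\<close>
definition jump_sol ::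
  "complex \<Rightarrow> (real \<Rightarrow> complex) \<Rightarrow> (real \<Rightarrow> complex) \<Rightarrow> complex \<Rightarrow> complex \<Rightarrow> complex \<Rightarrow> complex \<Rightarrow> bool" where
  "jump_sol lam f g A B p q \<longleftrightarrow>
     continuous_on UNIV g \<and> g 0 = 0 \<and>
     (\<exists>g1 g2.
        (\<forall>x. x \<noteq> -1 \<and> x \<noteq> 1 \<longrightarrow>
            (g has_vector_derivative g1 x) (at x) \<and> (g1 has_vector_derivative g2 x) (at x)) \<and>
        (\<forall>x. x \<noteq> -1 \<and> x \<noteq> 1 \<longrightarrow>
            g2 x - (if \<bar>x\<bar> < 1 then g2 0 else 0) - lam * g x = f x) \<and>
        g1 0 = A \<and> g2 0 = B \<and>
        (\<exists>a b c d.
            (g1 \<longlongrightarrow> a) (at_left (-1)) \<and> (g1 \<longlongrightarrow> b) (at_right (-1)) \<and>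
            (g1 \<longlongrightarrow> c) (at_left 1) \<and> (g1 \<longlongrightarrow> d) (at_right 1) \<and>
            b - a = p \<and> d - c = q))"

lemma jump_solI:
  assumes "continuous_on UNIV g" "g 0 = 0"
    "\<And>x. x \<noteq> -1 \<Longrightarrow> x \<noteq> 1 \<Longrightarrow> (g has_vector_derivative g1 x) (at x)"
    "\<And>x. x \<noteq> -1 \<Longrightarrow> x \<noteq> 1 \<Longrightarrow> (g1 has_vector_derivative g2 x) (at x)"
    "\<And>x. x \<noteq> -1 \<Longrightarrow> x \<noteq> 1 \<Longrightarrow> g2 x - (if \<bar>x\<bar> < 1 then g2 0 else 0) - lam * g x = f x"
    "g1 0 = A" "g2 0 = B"
    "(g1 \<longlongrightarrow> a) (at_left (-1))" "(g1 \<longlongrightarrow> b) (at_right (-1))"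
    "(g1 \<longlongrightarrow> c) (at_left 1)" "(g1 \<longlongrightarrow> d) (at_right 1)" "b - a = p" "d - c = q"
  shows "jump_sol lam f g A B p q"
  unfolding jump_sol_def
  by (rule conjI[OF assms(1) conjI[OF assms(2)]], rule exI[of _ g1], rule exI[of _ g2],
      intro conjI, use assms(3,4) in blast, use assms(5) in blast, fact, fact,
      rule exI[of _ a], rule exI[of _ b], rule exI[of _ c], rule exI[of _ d], intro conjI; fact)

lemma jump_solE:
  assumes "jump_sol lam f g A B p q"
  obtains g1 g2 a b c d where "continuous_on UNIV g" "g 0 = 0"
    "\<And>x. x \<noteq> -1 \<Longrightarrow> x \<noteq> 1 \<Longrightarrow> (g has_vector_derivative g1 x) (at x)"
    "\<And>x. x \<noteq> -1 \<Longrightarrow> x \<noteq> 1 \<Longrightarrow> (g1 has_vector_derivative g2 x) (at x)"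
    "\<And>x. x \<noteq> -1 \<Longrightarrow> x \<noteq> 1 \<Longrightarrow> g2 x - (if \<bar>x\<bar> < 1 then g2 0 else 0) - lam * g x = f x"
    "g1 0 = A" "g2 0 = B"
    "(g1 \<longlongrightarrow> a) (at_left (-1))" "(g1 \<longlongrightarrow> b) (at_right (-1))"
    "(g1 \<longlongrightarrow> c) (at_left 1)" "(g1 \<longlongrightarrow> d) (at_right 1)" "b - a = p" "d - c = q"
  using assms unfolding jump_sol_def
proof (elim exE conjE, goal_cases)
  case (1 g1 g2 a b c d)
  show ?case by (rule 1(1)[of g1 g2 a b c d]) (use 1(4,5) in \<open>simp_all add: 1(2,3,6-)\<close>)
qed

lemma L1_eq_iff_jump_sol:
  "L1_eq R lam f g \<longleftrightarrow>
     (\<exists>A B. jump_sol lam f g A B (A + complex_of_real R * B) (- A + complex_of_real R * B))"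
proof
  assume "L1_eq R lam f g"
  then show "\<exists>A B. jump_sol lam f g A B (A + complex_of_real R * B) (- A + complex_of_real R * B)"
    unfolding L1_eq_def
  proof (elim exE conjE, goal_cases)
    case (1 g1 g2 a b c d)
    have "jump_sol lam f g (g1 0) (g2 0) (b - a) (d - c)"
      by (rule jump_solI[where ?g1.0 = g1 and ?g2.0 = g2]) (use 1(3,4) in \<open>simp_all add: 1(1,2,5-8)\<close>)
    then show ?case unfolding 1(9,10) by blast
  qed
next
  assume "\<exists>A B. jump_sol lam f g A B (A + complex_of_real R * B) (- A + complex_of_real R * B)"
  then obtain A B where "jump_sol lam f g A B (A + complex_of_real R * B) (- A + complex_of_real R * B)" by blast
  then show "L1_eq R lam f g"
  proof (cases rule: jump_solE)
    case (1 g1 g2 a b c d)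
    show ?thesis unfolding L1_eq_def
    proof (rule conjI[OF 1(1) conjI[OF 1(2)]], rule exI[of _ g1], rule exI[of _ g2], intro conjI allI impI)
      show "\<exists>a b c d. (g1 \<longlongrightarrow> a) (at_left (-1)) \<and> (g1 \<longlongrightarrow> b) (at_right (-1)) \<and>
            (g1 \<longlongrightarrow> c) (at_left 1) \<and> (g1 \<longlongrightarrow> d) (at_right 1) \<and>
            b - a = g1 0 + complex_of_real R * g2 0 \<and> d - c = - g1 0 + complex_of_real R * g2 0"
        unfolding 1(6,7) by (rule exI[of _ a], rule exI[of _ b], rule exI[of _ c], rule exI[of _ d], intro conjI 1(8-))
    qed (erule conjE, rule 1(3,4,5), assumption+)+
  qed
qed

lemma jump_sol_lincomb:
  assumes "jump_sol lam f g A B p q" "jump_sol lam f' g' A' B' p' q'"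
  shows "jump_sol lam (\<lambda>x. f x + k * f' x) (\<lambda>x. g x + k * g' x)
           (A + k * A') (B + k * B') (p + k * p') (q + k * q')"
proof -
  obtain g1 g2 a b c d where 1: "continuous_on UNIV g" "g 0 = 0"
    "\<And>x. x \<noteq> -1 \<Longrightarrow> x \<noteq> 1 \<Longrightarrow> (g has_vector_derivative g1 x) (at x)"
    "\<And>x. x \<noteq> -1 \<Longrightarrow> x \<noteq> 1 \<Longrightarrow> (g1 has_vector_derivative g2 x) (at x)"
    "\<And>x. x \<noteq> -1 \<Longrightarrow> x \<noteq> 1 \<Longrightarrow> g2 x - (if \<bar>x\<bar> < 1 then g2 0 else 0) - lam * g x = f x"
    "g1 0 = A" "g2 0 = B"
    "(g1 \<longlongrightarrow> a) (at_left (-1))" "(g1 \<longlongrightarrow> b) (at_right (-1))"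
    "(g1 \<longlongrightarrow> c) (at_left 1)" "(g1 \<longlongrightarrow> d) (at_right 1)" "b - a = p" "d - c = q"
    by (fact jump_solE[OF assms(1)])
  obtain h1 h2 a' b' c' d' where 2: "continuous_on UNIV g'" "g' 0 = 0"
    "\<And>x. x \<noteq> -1 \<Longrightarrow> x \<noteq> 1 \<Longrightarrow> (g' has_vector_derivative h1 x) (at x)"
    "\<And>x. x \<noteq> -1 \<Longrightarrow> x \<noteq> 1 \<Longrightarrow> (h1 has_vector_derivative h2 x) (at x)"
    "\<And>x. x \<noteq> -1 \<Longrightarrow> x \<noteq> 1 \<Longrightarrow> h2 x - (if \<bar>x\<bar> < 1 then h2 0 else 0) - lam * g' x = f' x"
    "h1 0 = A'" "h2 0 = B'"
    "(h1 \<longlongrightarrow> a') (at_left (-1))" "(h1 \<longlongrightarrow> b') (at_right (-1))"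
    "(h1 \<longlongrightarrow> c') (at_left 1)" "(h1 \<longlongrightarrow> d') (at_right 1)" "b' - a' = p'" "d' - c' = q'"
    by (fact jump_solE[OF assms(2)])
  let ?g1 = "\<lambda>x. g1 x + k * h1 x" and ?g2 = "\<lambda>x. g2 x + k * h2 x"
  show ?thesis
  proof (rule jump_solI[where ?g1.0 = ?g1 and ?g2.0 = ?g2 and a = "a + k * a'" and b = "b + k * b'"
      and c = "c + k * c'" and d = "d + k * d'"])
    fix x :: real assume x: "x \<noteq> -1" "x \<noteq> 1"
    show "((\<lambda>x. g x + k * g' x) has_vector_derivative ?g1 x) (at x)"
      by (intro has_vector_derivative_add has_vector_derivative_mult_right 1(3) 2(3) x)
    show "(?g1 has_vector_derivative ?g2 x) (at x)"
      by (intro has_vector_derivative_add has_vector_derivative_mult_right 1(4) 2(4) x)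
    show "?g2 x - (if \<bar>x\<bar> < 1 then ?g2 0 else 0) - lam * (g x + k * g' x) = f x + k * f' x"
      unfolding 1(5)[OF x, symmetric] 2(5)[OF x, symmetric] by (simp add: algebra_simps)
  next
    show "b + k * b' - (a + k * a') = p + k * p'" "d + k * d' - (c + k * c') = q + k * q'"
      unfolding 1(12,13)[symmetric] 2(12,13)[symmetric] by (simp_all add: algebra_simps)
  next
    show "continuous_on UNIV (\<lambda>x. g x + k * g' x)" by (intro continuous_intros 1 2)
    show "g 0 + k * g' 0 = 0" "?g1 0 = A + k * A'" "?g2 0 = B + k * B'" by (simp_all add: 1 2)
  qed (intro tendsto_add tendsto_mult_left 1 2)+
qed

text \<open>Transfers results about the half line x >= 0 to x <= 0. The jumps trade places with
  unchanged sign: \<open>g'\<close> changes sign and its one-sided limits are exchanged.\<close>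

lemma jump_sol_reflect:
  assumes "jump_sol lam f g A B p q"
  shows "jump_sol lam (\<lambda>x. f (- x)) (\<lambda>x. g (- x)) (- A) B q p"
proof -
  obtain g1 g2 a b c d where 1: "continuous_on UNIV g" "g 0 = 0"
    "\<And>x. x \<noteq> -1 \<Longrightarrow> x \<noteq> 1 \<Longrightarrow> (g has_vector_derivative g1 x) (at x)"
    "\<And>x. x \<noteq> -1 \<Longrightarrow> x \<noteq> 1 \<Longrightarrow> (g1 has_vector_derivative g2 x) (at x)"
    "\<And>x. x \<noteq> -1 \<Longrightarrow> x \<noteq> 1 \<Longrightarrow> g2 x - (if \<bar>x\<bar> < 1 then g2 0 else 0) - lam * g x = f x"
    "g1 0 = A" "g2 0 = B"
    "(g1 \<longlongrightarrow> a) (at_left (-1))" "(g1 \<longlongrightarrow> b) (at_right (-1))"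
    "(g1 \<longlongrightarrow> c) (at_left 1)" "(g1 \<longlongrightarrow> d) (at_right 1)" "b - a = p" "d - c = q"
    by (fact jump_solE[OF assms(1)])
  have D: "((\<lambda>x. u (- x)) has_vector_derivative - u') (at x)"
    if "(u has_vector_derivative u') (at (- x))" for u :: "real \<Rightarrow> complex" and u' x
    using vector_diff_chain_at[OF has_vector_derivative_minus[OF has_vector_derivative_id] that]
    by (simp add: o_def)
  show ?thesis
  proof (rule jump_solI[where ?g1.0 = "\<lambda>x. - g1 (- x)" and ?g2.0 = "\<lambda>x. g2 (- x)" and a = "- d" and b = "- c"
      and c = "- b" and d = "- a"])
    fix x :: real assume x: "x \<noteq> -1" "x \<noteq> 1"
    then have x': "- x \<noteq> -1" "- x \<noteq> 1" by auto
    show "((\<lambda>x. g (- x)) has_vector_derivative - g1 (- x)) (at x)"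
      using D[OF 1(3)[OF x']] .
    show "((\<lambda>x. - g1 (- x)) has_vector_derivative g2 (- x)) (at x)"
      using has_vector_derivative_minus[OF D[OF 1(4)[OF x']]] by simp
    show "g2 (- x) - (if \<bar>x\<bar> < 1 then g2 (- 0) else 0) - lam * g (- x) = f (- x)"
      using 1(5)[OF x'] by (simp only: abs_minus_cancel minus_zero)
  next
    show "continuous_on UNIV (\<lambda>x. g (- x))"
      by (intro continuous_on_compose2[OF 1(1)] continuous_intros) auto
  next
    show "((\<lambda>x. - g1 (- x)) \<longlongrightarrow> - d) (at_left (-1))" "((\<lambda>x. - g1 (- x)) \<longlongrightarrow> - b) (at_left 1)"
      using 1(9,11) by (simp_all add: filterlim_at_left_to_right tendsto_minus)
    show "((\<lambda>x. - g1 (- x)) \<longlongrightarrow> - c) (at_right (-1))" "((\<lambda>x. - g1 (- x)) \<longlongrightarrow> - a) (at_right 1)"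
      using 1(8,10) by (simp_all add: at_right_minus[of 1] at_right_minus[of "-1"] filterlim_filtermap tendsto_minus)
  qed (use 1(2,6,7,12,13) in auto)
qed

text \<open>Shows that a solution with \<open>g''(0) = 1\<close>, such as \<open>mode\<close> below,
  is not identically zero.\<close>

lemma jump_sol_zero_imp:
  assumes "jump_sol lam f (\<lambda>_. 0) A B p q"
  shows "B = 0"
proof -
  obtain g1 g2 a b c d where 1: "continuous_on UNIV (\<lambda>_::real. 0::complex)" "(0::complex) = 0"
    "\<And>x. x \<noteq> -1 \<Longrightarrow> x \<noteq> 1 \<Longrightarrow> ((\<lambda>_. 0) has_vector_derivative g1 x) (at x)"
    "\<And>x. x \<noteq> -1 \<Longrightarrow> x \<noteq> 1 \<Longrightarrow> (g1 has_vector_derivative g2 x) (at x)"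
    "\<And>x. x \<noteq> -1 \<Longrightarrow> x \<noteq> 1 \<Longrightarrow> g2 x - (if \<bar>x\<bar> < 1 then g2 0 else 0) - lam * 0 = f x"
    "g1 0 = A" "g2 0 = B"
    "(g1 \<longlongrightarrow> a) (at_left (-1))" "(g1 \<longlongrightarrow> b) (at_right (-1))"
    "(g1 \<longlongrightarrow> c) (at_left 1)" "(g1 \<longlongrightarrow> d) (at_right 1)" "b - a = p" "d - c = q"
    by (fact jump_solE[OF assms])
  have "g1 x = 0" if "x \<in> {-1<..<1}" for x
    using vector_derivative_unique_at[OF 1(3)[of x] has_vector_derivative_const] that by auto
  then have "((\<lambda>_. 0) has_vector_derivative g2 0) (at 0)"
    by (intro has_vector_derivative_transform_within_open[OF 1(4), of 0 "{-1<..<1}"]) auto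
  from vector_derivative_unique_at[OF this has_vector_derivative_const] 1(7) show ?thesis by simp
qed

text \<open>Factoring \<open>g'' - \<mu>\<^sup>2 g = B\<close> as \<open>(\<partial> - \<mu>) (\<partial> + \<mu>) g = B\<close>; the other factorisation is obtained
  with \<open>- \<mu>\<close> for \<open>\<mu>\<close>.\<close>
lemma first_order_factor:
  fixes g g1 g2 :: "real \<Rightarrow> complex" and \<mu> B :: complex
  assumes "convex S" "x \<in> S" "y \<in> S" "\<mu> \<noteq> 0"
    and d: "\<And>x. x \<in> S \<Longrightarrow> (g has_vector_derivative g1 x) (at x)"
      "\<And>x. x \<in> S \<Longrightarrow> (g1 has_vector_derivative g2 x) (at x)"
    and eq: "\<And>x. x \<in> S \<Longrightarrow> g2 x = B + \<mu>\<^sup>2 * g x"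
  shows "g1 x + \<mu> * g x + B / \<mu> = (g1 y + \<mu> * g y + B / \<mu>) * exp (\<mu> * of_real (x - y))"
proof -
  \<comment> \<open>With this integrating factor the derivative is
    \<open>(g'' - mu^2 g - B) exp (- mu x)\<close>, which vanishes by the equation.\<close>
  let ?u = "\<lambda>x. (g1 x + \<mu> * g x + B / \<mu>) * exp (- \<mu> * of_real x)"
  have "(?u has_vector_derivative 0) (at z within S)" if "z \<in> S" for z
  proof -
    have e: "((\<lambda>x. exp (- \<mu> * of_real x)) has_vector_derivative exp (- \<mu> * of_real z) * (- \<mu>)) (at z within S)"
      by (rule has_vector_derivative_real_field) (auto intro!: derivative_eq_intros)
    note D = has_vector_derivative_mult[OF has_vector_derivative_add[OF has_vector_derivative_add[OF
          has_vector_derivative_at_within[OF d(2)[OF that]]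
          has_vector_derivative_mult_right[OF has_vector_derivative_at_within[OF d(1)[OF that]], of \<mu>]]
          has_vector_derivative_const[of "B / \<mu>"]] e]
    show ?thesis
      using D \<open>\<mu> \<noteq> 0\<close> by (simp add: eq[OF that] power2_eq_square field_simps)
  qed
  from has_vector_derivative_zero_constant[OF \<open>convex S\<close> this]
  obtain k where "\<And>z. z \<in> S \<Longrightarrow> ?u z = k" by blast
  then have 1: "?u x = ?u y" using assms(2,3) by metis
  have 2: "exp (\<mu> * of_real (x - y)) = exp (- \<mu> * of_real y) / exp (- \<mu> * of_real x)"
    by (simp add: algebra_simps flip: exp_diff)
  have 3: "a = b * (f / e)" if "a * e = b * f" "e \<noteq> 0" for a b e f :: complex
    using that by (simp add: field_simps)
  show ?thesis unfolding 2 by (rule 3[OF 1]) simp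
qed

lemma bounded_exp_coeff_zero:
  fixes k C :: complex
  assumes "Re k > 0" and bd: "\<And>x::real. x > x0 \<Longrightarrow> norm (C * exp (k * of_real x)) \<le> M"
  shows "C = 0"
proof (rule ccontr)
  assume "C \<noteq> 0"
  \<comment> \<open>A point beyond \<open>x0\<close> at which already the exponent
    \<open>Re k * x\<close> is at least \<open>|M| / |C|\<close>.\<close>
  define x where "x = max (x0 + 1) (\<bar>M\<bar> / norm C / Re k)"
  have "\<bar>M\<bar> / norm C \<le> Re k * x"
    using mult_left_mono[of "\<bar>M\<bar> / norm C / Re k" x "Re k"] assms(1) by (simp add: x_def)
  also have "\<dots> < exp (Re k * x)" using exp_ge_add_one_self[of "Re k * x"] by linarith
  finally have "\<bar>M\<bar> < norm C * exp (Re k * x)" using \<open>C \<noteq> 0\<close> by (simp add: field_simps)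
  moreover have "norm (C * exp (k * of_real x)) \<le> M" by (rule bd) (simp add: x_def)
  ultimately show False by (simp add: norm_mult norm_exp_eq_Re)
qed

section \<open>Bounded solutions: jump relations and uniqueness\<close>

text \<open>On the left of 1 the factor \<open>g' + mu g\<close> is known from A and B; on the right
  boundedness forces \<open>g' = - mu g\<close>. Adding the two limits at 1 eliminates the unknown
  value \<open>g 1\<close> and leaves the jump.\<close>

lemma bounded_jump_sol_right:
  assumes sol: "jump_sol (\<mu>\<^sup>2) (\<lambda>_. 0) g A B p q" and bd: "bounded (range g)" and \<mu>: "Re \<mu> > 0"
  shows "q = B / \<mu> - (A + B / \<mu>) * exp \<mu>"
    and "A = 0 \<Longrightarrow> B = 0 \<Longrightarrow> x \<ge> 0 \<Longrightarrow> g x = 0"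
proof -
  have \<mu>0: "\<mu> \<noteq> 0" "- \<mu> \<noteq> 0" using \<mu> by auto
  obtain g1 g2 a b c d where cont: "continuous_on UNIV g" and g0: "g 0 = 0"
    and der: "\<And>x. x \<noteq> -1 \<Longrightarrow> x \<noteq> 1 \<Longrightarrow> (g has_vector_derivative g1 x) (at x)"
      "\<And>x. x \<noteq> -1 \<Longrightarrow> x \<noteq> 1 \<Longrightarrow> (g1 has_vector_derivative g2 x) (at x)"
    and eq: "\<And>x. x \<noteq> -1 \<Longrightarrow> x \<noteq> 1 \<Longrightarrow> g2 x - (if \<bar>x\<bar> < 1 then g2 0 else 0) - \<mu>\<^sup>2 * g x = 0"
    and AB: "g1 0 = A" "g2 0 = B"
    and lims': "(g1 \<longlongrightarrow> a) (at_left (-1))" "(g1 \<longlongrightarrow> b) (at_right (-1))"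
    and lims: "(g1 \<longlongrightarrow> c) (at_left 1)" "(g1 \<longlongrightarrow> d) (at_right 1)" "b - a = p" "d - c = q"
    by (fact jump_solE[OF sol])
  have lg: "(g \<longlongrightarrow> g 1) (at 1 within T)" for T
    by (rule tendsto_within_subset[of _ _ _ UNIV]) (use cont in \<open>simp_all add: continuous_on_def\<close>)
  have eqin: "g2 x = B + \<mu>\<^sup>2 * g x" if "x \<in> {-1<..<1}" for x using eq[of x] that AB by (auto simp: abs_less_iff algebra_simps)
  have eqout: "g2 x = 0 + \<mu>\<^sup>2 * g x" if "x \<in> {1<..}" for x using eq[of x] that by (auto simp: algebra_simps)
  have din: "(g has_vector_derivative g1 x) (at x)" "(g1 has_vector_derivative g2 x) (at x)"
    if "x \<in> {-1<..<1}" for x using that der[of x] by auto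
  have dout: "(g has_vector_derivative g1 x) (at x)" "(g1 has_vector_derivative g2 x) (at x)"
    if "x \<in> {1<..}" for x using that der[of x] by auto
  \<comment> \<open>Both factorisations, based at 0, where g vanishes and
    \<open>g' = A\<close>.\<close>
  have inner: "g1 x + \<mu> * g x + B / \<mu> = (A + B / \<mu>) * exp (\<mu> * of_real x)"
    "g1 x - \<mu> * g x - B / \<mu> = (A - B / \<mu>) * exp (- \<mu> * of_real x)" if "x \<in> {-1<..<1}" for x
    using first_order_factor[OF _ that _ \<mu>0(1) din eqin, where y = 0]
      first_order_factor[OF _ that _ \<mu>0(2) din, where y = 0 and B = B] eqin
    by (simp_all add: AB g0)
  have outer: "g1 x + \<mu> * g x = (g1 2 + \<mu> * g 2) * exp (\<mu> * of_real (x - 2))"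
    "g1 x - \<mu> * g x = (g1 2 - \<mu> * g 2) * exp (- \<mu> * of_real (x - 2))" if "x > 1" for x
    using first_order_factor[OF _ _ _ \<mu>0(1) dout eqout, where x = x and y = 2 and S = "{1<..}"]
      first_order_factor[OF _ _ _ \<mu>0(2) dout, where x = x and y = 2 and B = 0 and S = "{1<..}"] eqout that
    by simp_all
  have decay: "g1 x = - \<mu> * g x" if "x > 1" for x
  proof -
    obtain M where M: "\<And>x. norm (g x) \<le> M" using bd by (auto simp: bounded_iff)
    \<comment> \<open>\<open>?C\<close> is the coefficient of the growing exponential. Subtracting
      the two outer identities expresses its term through \<open>2 mu g\<close> and a decaying
      exponential, so the term is bounded.\<close>
    let ?C = "(g1 2 + \<mu> * g 2) * exp (- 2 * \<mu>)" and ?D = "g1 2 - \<mu> * g 2"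
    have "?C = 0"
    proof (rule bounded_exp_coeff_zero[OF \<mu>])
      fix y :: real assume "y > 2"
      have "?C * exp (\<mu> * of_real y) = 2 * \<mu> * g y + ?D * exp (- \<mu> * of_real (y - 2))"
      proof -
        have "exp (- 2 * \<mu>) * exp (\<mu> * of_real y) = exp (\<mu> * of_real (y - 2))"
          by (simp add: algebra_simps flip: exp_add)
        then have "?C * exp (\<mu> * of_real y) = g1 y + \<mu> * g y"
          using outer(1)[of y] \<open>y > 2\<close> by (simp add: mult.assoc)
        then show ?thesis using outer(2)[of y] \<open>y > 2\<close> by (simp add: algebra_simps)
      qed
      also have "norm \<dots> \<le> norm (2 * \<mu> * g y) + norm (?D * exp (- \<mu> * of_real (y - 2)))"
        by (rule norm_triangle_ineq)
      also have "\<dots> \<le> 2 * norm \<mu> * M + norm ?D * 1"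
      proof (intro add_mono)
        show "norm (2 * \<mu> * g y) \<le> 2 * norm \<mu> * M" using M[of y] by (simp add: norm_mult mult_left_mono)
        show "norm (?D * exp (- \<mu> * of_real (y - 2))) \<le> norm ?D * 1"
          unfolding norm_mult using \<mu> \<open>y > 2\<close> by (intro mult_left_mono) (auto simp: norm_exp_eq_Re)
      qed
      finally show "norm (?C * exp (\<mu> * of_real y)) \<le> 2 * norm \<mu> * M + norm ?D * 1" .
    qed
    then have "g1 2 + \<mu> * g 2 = 0" by simp
    then show ?thesis using outer(1)[OF that] by (simp add: add_eq_0_iff)
  qed
  have ev_in: "eventually (\<lambda>x. x \<in> {-1<..<1}) (at_left (1::real))"
    by (rule eventually_at_leftI[of "-1"]) auto
  have ev_out: "eventually (\<lambda>x. x > 1) (at_right (1::real))"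
    by (rule eventually_at_rightI[of 1 2]) auto
  have lexp: "((\<lambda>x. C * exp (k * of_real (x - e))) \<longlongrightarrow> C * exp (k * of_real (1 - e))) (at 1 within T)"
    for C k :: complex and e T
  proof -
    have "isCont (\<lambda>x::real. C * exp (k * of_real (x - e))) 1" by (intro continuous_intros)
    then show ?thesis unfolding isCont_def by (rule tendsto_within_subset) simp
  qed
  have "((\<lambda>x. g1 x + \<mu> * g x + B / \<mu>) \<longlongrightarrow> (A + B / \<mu>) * exp (\<mu> * of_real 1)) (at_left 1)"
    by (rule Lim_transform_eventually[OF _ eventually_mono[OF ev_in inner(1)[symmetric]]])
      (use lexp[of "A + B / \<mu>" \<mu> 0] in simp)
  from tendsto_unique[OF _ this tendsto_add[OF tendsto_add[OF lims(1) tendsto_mult[OF tendsto_const lg]] tendsto_const]]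
  have c: "(A + B / \<mu>) * exp \<mu> = c + \<mu> * g 1 + B / \<mu>" by simp
  have "(g1 \<longlongrightarrow> - \<mu> * g 1) (at_right 1)"
    by (rule Lim_transform_eventually[OF _ eventually_mono[OF ev_out decay[symmetric]]])
      (intro tendsto_mult tendsto_const lg)
  from tendsto_unique[OF _ this lims(2)] have d: "- \<mu> * g 1 = d" by simp
  show "q = B / \<mu> - (A + B / \<mu>) * exp \<mu>"
    unfolding c lims(4)[symmetric] d[symmetric] by (simp add: algebra_simps)
  show "g x = 0" if "A = 0" "B = 0" "x \<ge> 0"
  proof -
    have in0: "g x = 0" if "x \<in> {-1<..<1}" for x
    proof -
      have "g1 x + \<mu> * g x = 0" "g1 x - \<mu> * g x = 0" using inner[OF that] \<open>A = 0\<close> \<open>B = 0\<close> by auto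
      then have "2 * \<mu> * g x = 0" by (simp add: algebra_simps)
      then show ?thesis using \<mu>0 by simp
    qed
    have "(g \<longlongrightarrow> 0) (at_left 1)"
      by (rule Lim_transform_eventually[OF tendsto_const eventually_mono[OF ev_in in0[symmetric]]])
    from tendsto_unique[OF _ this lg] have g1': "g 1 = 0" by simp
    \<comment> \<open>The surviving outer constant is read off from the right limit at 1, where
      \<open>g 1 = 0\<close> and hence \<open>d = 0\<close>.\<close>
    have "((\<lambda>x. g1 x - \<mu> * g x) \<longlongrightarrow> (g1 2 - \<mu> * g 2) * exp (- \<mu> * of_real (1 - 2))) (at_right 1)"
      by (rule Lim_transform_eventually[OF _ eventually_mono[OF ev_out outer(2)[symmetric]]])
        (rule lexp)
    from tendsto_unique[OF _ this tendsto_diff[OF lims(2) tendsto_mult[OF tendsto_const lg]]]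
    have "(g1 2 - \<mu> * g 2) * exp \<mu> = d - \<mu> * g 1" by simp
    then have "g1 2 - \<mu> * g 2 = 0" using d g1' by auto
    then have "g x = 0" if "x > 1" for x
      using outer(2)[OF that] decay[OF that] \<mu>0 by simp
    then show ?thesis using in0[of x] g1' \<open>x \<ge> 0\<close> by (cases "x = 1"; cases "x > 1") auto
  qed
qed

text \<open>The relation at -1 is the reflected one at 1, with A replaced by -A. The sum of the
  jumps therefore involves only B, and their difference only A.\<close>

lemma bounded_jump_sol_jumps:
  assumes sol: "jump_sol (\<mu>\<^sup>2) (\<lambda>_. 0) g A B p q" and bd: "bounded (range g)" and \<mu>: "Re \<mu> > 0"
  shows "p = A * exp \<mu> + B * ((1 - exp \<mu>) / \<mu>)" "q = - A * exp \<mu> + B * ((1 - exp \<mu>) / \<mu>)"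
proof -
  have "\<mu> \<noteq> 0" using \<mu> by auto
  have bd': "bounded (range (\<lambda>x. g (- x)))" using bd by (auto simp: bounded_iff)
  show "p = A * exp \<mu> + B * ((1 - exp \<mu>) / \<mu>)"
    using bounded_jump_sol_right(1)[OF jump_sol_reflect[OF sol, simplified] bd' \<mu>] \<open>\<mu> \<noteq> 0\<close>
    by (simp add: field_simps)
  show "q = - A * exp \<mu> + B * ((1 - exp \<mu>) / \<mu>)"
    using bounded_jump_sol_right(1)[OF sol bd \<mu>] \<open>\<mu> \<noteq> 0\<close> by (simp add: field_simps)
qed

text \<open>By linearity, this makes a bounded solution unique for given right-hand side and data A,
  B.\<close>

lemma bounded_jump_sol_trivial:
  assumes sol: "jump_sol (\<mu>\<^sup>2) (\<lambda>_. 0) g 0 0 p q" and bd: "bounded (range g)" and \<mu>: "Re \<mu> > 0"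
  shows "g = (\<lambda>_. 0)"
proof
  fix x
  have bd': "bounded (range (\<lambda>x. g (- x)))" using bd by (auto simp: bounded_iff)
  show "g x = 0"
    using bounded_jump_sol_right(2)[OF sol bd \<mu>, of x]
      bounded_jump_sol_right(2)[OF jump_sol_reflect[OF sol, simplified] bd' \<mu>, of "- x"] by (cases "x \<ge> 0") auto
qed

section \<open>Construction of even solutions\<close>

text \<open>Both profiles are differentiable on the whole line, so the one-sided limits of
  \<open>g'\<close> at 1 are plain values. Evenness gives \<open>g'(0) = 0\<close> and equal jumps
  at -1 and 1. The lemma serves both \<open>mode\<close> and \<open>mode_deriv\<close>.\<close>

lemma jump_sol_even_glue:
  fixes \<phi> \<phi>1 \<phi>2 \<psi> \<psi>1 \<psi>2 :: "real \<Rightarrow> complex"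
  assumes \<phi>: "\<And>x. (\<phi> has_vector_derivative \<phi>1 x) (at x)" "\<And>x. (\<phi>1 has_vector_derivative \<phi>2 x) (at x)"
    and \<psi>: "\<And>x. (\<psi> has_vector_derivative \<psi>1 x) (at x)" "\<And>x. (\<psi>1 has_vector_derivative \<psi>2 x) (at x)"
    and even: "\<And>x. \<phi> (- x) = \<phi> x" "\<And>x. \<phi>1 (- x) = - \<phi>1 x" "\<And>x. \<phi>2 (- x) = \<phi>2 x" "\<And>x. f (- x) = f x"
    and \<phi>0: "\<phi> 0 = 0" and glue: "\<phi> 1 = \<psi> 1"
    and eqin: "\<And>x. \<bar>x\<bar> < 1 \<Longrightarrow> \<phi>2 x - \<phi>2 0 - lam * \<phi> x = f x"
    and eqout: "\<And>x. x > 1 \<Longrightarrow> \<psi>2 x - lam * \<psi> x = f x"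
  shows "jump_sol lam f (\<lambda>x. if \<bar>x\<bar> \<le> 1 then \<phi> x else \<psi> \<bar>x\<bar>) 0 (\<phi>2 0) (\<psi>1 1 - \<phi>1 1) (\<psi>1 1 - \<phi>1 1)"
proof -
  let ?g = "\<lambda>x. if \<bar>x\<bar> \<le> 1 then \<phi> x else \<psi> \<bar>x\<bar>"
  let ?g1 = "\<lambda>x. if \<bar>x\<bar> \<le> 1 then \<phi>1 x else if x > 0 then \<psi>1 x else - \<psi>1 (- x)"
  let ?g2 = "\<lambda>x. if \<bar>x\<bar> \<le> 1 then \<phi>2 x else \<psi>2 \<bar>x\<bar>"
  have refl: "((\<lambda>x. u (- x)) has_vector_derivative - u') (at x)"
    if "(u has_vector_derivative u') (at (- x))" for u :: "real \<Rightarrow> complex" and u' x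
    using vector_diff_chain_at[OF has_vector_derivative_minus[OF has_vector_derivative_id] that]
    by (simp add: o_def)
  have cont: "continuous_on T \<phi>" "continuous_on T \<psi>" for T
    by (rule continuous_at_imp_continuous_on, rule ballI, rule has_vector_derivative_continuous, rule \<phi> \<psi>)+
  have lim: "(\<phi>1 \<longlongrightarrow> \<phi>1 x) (at x within T)" "(\<psi>1 \<longlongrightarrow> \<psi>1 x) (at x within T)" for x T
    using has_vector_derivative_continuous[OF \<phi>(2)[of x]] has_vector_derivative_continuous[OF \<psi>(2)[of x]]
    unfolding isCont_def by (auto intro: tendsto_within_subset)
  have \<phi>11: "\<phi>1 (-1) = - \<phi>1 1" by (rule even(2))
  have outer: "(?g has_vector_derivative ?g1 x) (at x) \<and> (?g1 has_vector_derivative ?g2 x) (at x)" if "\<bar>x\<bar> > 1" for x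
  proof (cases "x > 0")
    case True
    with that have "x \<in> {1<..}" using that by auto
    have "(?g has_vector_derivative \<psi>1 x) (at x)"
      by (rule has_vector_derivative_transform_within_open[OF \<psi>(1) open_greaterThan \<open>x \<in> {1<..}\<close>]) auto
    moreover have "(?g1 has_vector_derivative \<psi>2 x) (at x)"
      by (rule has_vector_derivative_transform_within_open[OF \<psi>(2) open_greaterThan \<open>x \<in> {1<..}\<close>]) auto
    ultimately show ?thesis using True that by simp
  next
    case False
    with that have "x \<in> {..< -1}" using that by auto
    have "(?g has_vector_derivative - \<psi>1 (- x)) (at x)"
      by (rule has_vector_derivative_transform_within_open[OF refl[OF \<psi>(1)] open_lessThan \<open>x \<in> {..< -1}\<close>]) auto
    moreover have "(?g1 has_vector_derivative - (- \<psi>2 (- x))) (at x)"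
      by (rule has_vector_derivative_transform_within_open
          [OF has_vector_derivative_minus[OF refl[OF \<psi>(2)]] open_lessThan \<open>x \<in> {..< -1}\<close>]) auto
    ultimately show ?thesis using False that by simp
  qed
  show ?thesis
  proof (rule jump_solI[where ?g1.0 = ?g1 and ?g2.0 = ?g2 and a = "- \<psi>1 1" and b = "- \<phi>1 1" and c = "\<phi>1 1" and d = "\<psi>1 1"])
    have "continuous_on ({x. \<bar>x\<bar> \<le> 1} \<union> {x. \<bar>x\<bar> \<ge> 1}) ?g"
    proof (rule continuous_on_If)
      show "continuous_on {x. 1 \<le> \<bar>x\<bar>} (\<lambda>x. \<psi> \<bar>x\<bar>)"
        by (intro continuous_on_compose2[OF cont(2)] continuous_intros) auto
      show "closed {x::real. \<bar>x\<bar> \<le> 1}"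
        by (intro closed_Collect_le continuous_intros)
      show "closed {x::real. 1 \<le> \<bar>x\<bar>}"
        by (intro closed_Collect_le continuous_intros)
      have "\<phi> x = \<psi> \<bar>x\<bar>" if "\<bar>x\<bar> = 1" for x
        using that glue even(1)[of 1] by (auto simp: abs_if split: if_splits)
      then show "\<And>x. x \<in> {x. \<bar>x\<bar> \<le> 1} \<Longrightarrow> \<not> \<bar>x\<bar> \<le> 1 \<Longrightarrow> \<phi> x = \<psi> \<bar>x\<bar>"
        "\<And>x. x \<in> {x. 1 \<le> \<bar>x\<bar>} \<Longrightarrow> \<bar>x\<bar> \<le> 1 \<Longrightarrow> \<phi> x = \<psi> \<bar>x\<bar>" by auto
    qed (rule cont)
    moreover have "{x. \<bar>x\<bar> \<le> 1} \<union> {x. \<bar>x\<bar> \<ge> 1} = (UNIV :: real set)" by auto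
    ultimately show "continuous_on UNIV ?g" by simp
  next
    fix x :: real assume x: "x \<noteq> -1" "x \<noteq> 1"
    show "(?g has_vector_derivative ?g1 x) (at x)"
    proof (cases "\<bar>x\<bar> < 1")
      case True
      then have "x \<in> {-1<..<1}" by auto
      then have "(?g has_vector_derivative \<phi>1 x) (at x)"
        by (rule has_vector_derivative_transform_within_open[OF \<phi>(1) open_greaterThanLessThan]) auto
      then show ?thesis using True by simp
    next
      case False then show ?thesis using outer x by force
    qed
    show "(?g1 has_vector_derivative ?g2 x) (at x)"
    proof (cases "\<bar>x\<bar> < 1")
      case True
      then have "x \<in> {-1<..<1}" by auto
      then have "(?g1 has_vector_derivative \<phi>2 x) (at x)"
        by (rule has_vector_derivative_transform_within_open[OF \<phi>(2) open_greaterThanLessThan]) auto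
      then show ?thesis using True by simp
    next
      case False then show ?thesis using outer x by force
    qed
    show "?g2 x - (if \<bar>x\<bar> < 1 then ?g2 0 else 0) - lam * ?g x = f x"
    proof (cases "\<bar>x\<bar> < 1")
      case True then show ?thesis using eqin[of x] by simp
    next
      case False
      then have "\<bar>x\<bar> > 1" using x by auto
      then show ?thesis using eqout[of "\<bar>x\<bar>"] even(4)[of x] by (auto simp: abs_if split: if_splits)
    qed
  next
    have "\<forall>\<^sub>F x in at_left (-1). - \<psi>1 (- x) = ?g1 x"
      by (rule eventually_at_leftI[of "-2"]) auto
    moreover have "((\<lambda>x. - \<psi>1 (- x)) \<longlongrightarrow> - \<psi>1 1) (at_left (-1))"
      using lim(2)[of 1 "{1<..}"] by (intro tendsto_minus) (simp add: at_left_minus[of "-1"] filterlim_filtermap)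
    ultimately show "(?g1 \<longlongrightarrow> - \<psi>1 1) (at_left (-1))" by (rule Lim_transform_eventually[rotated])
    have "\<forall>\<^sub>F x in at_right (-1). \<phi>1 x = ?g1 x"
      by (rule eventually_at_rightI[of _ 1]) auto
    then show "(?g1 \<longlongrightarrow> - \<phi>1 1) (at_right (-1))"
      using lim(1)[of "-1" "{-1<..}"] unfolding \<phi>11 by (rule Lim_transform_eventually[rotated])
    have "\<forall>\<^sub>F x in at_left 1. \<phi>1 x = ?g1 x"
      by (rule eventually_at_leftI[of "-1"]) auto
    then show "(?g1 \<longlongrightarrow> \<phi>1 1) (at_left 1)"
      using lim(1)[of "1" "{..<1}"] by (rule Lim_transform_eventually[rotated])
    have "\<forall>\<^sub>F x in at_right 1. \<psi>1 x = ?g1 x"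
      by (rule eventually_at_rightI[of _ 2]) auto
    then show "(?g1 \<longlongrightarrow> \<psi>1 1) (at_right 1)"
      using lim(2)[of "1" "{1<..}"] by (rule Lim_transform_eventually[rotated])
  qed (use \<phi>0 even(2)[of 0] in auto)
qed

lemma bounded_even_glue:
  fixes \<phi> \<psi> :: "real \<Rightarrow> complex"
  assumes "continuous_on {-1..1} \<phi>" and "\<And>x. x > 1 \<Longrightarrow> norm (\<psi> x) \<le> M"
  shows "bounded (range (\<lambda>x. if \<bar>x\<bar> \<le> 1 then \<phi> x else \<psi> \<bar>x\<bar>))"
proof -
  have "bounded (\<phi> ` {-1..1})"
    by (intro compact_imp_bounded compact_continuous_image assms compact_Icc)
  then obtain N where N: "\<forall>y \<in> \<phi> ` {-1..1}. norm y \<le> N" unfolding bounded_iff by blast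
  have "norm (if \<bar>x\<bar> \<le> 1 then \<phi> x else \<psi> \<bar>x\<bar>) \<le> max M N" for x
    using N assms(2)[of "\<bar>x\<bar>"] by (auto simp: abs_le_iff le_max_iff_disj)
  then show ?thesis unfolding bounded_iff by blast
qed

section \<open>Eigenfunctions\<close>

text \<open>Inside: the even solution of \<open>g'' - mu^2 g = g''(0)\<close> with
  \<open>g(0) = 0\<close>, normalised by \<open>g''(0) = 1\<close>. Outside: the decaying
  exponential that continues it.\<close>

definition mode :: "complex \<Rightarrow> real \<Rightarrow> complex" where
  "mode \<mu> x = (if \<bar>x\<bar> \<le> 1 then (cosh (\<mu> * of_real x) - 1) / \<mu>\<^sup>2
     else (cosh \<mu> - 1) / \<mu>\<^sup>2 * exp (- \<mu> * of_real (\<bar>x\<bar> - 1)))"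

text \<open>The derivative of \<open>mode\<close> with respect to \<open>\<mu>\<close>; differentiating the eigenvalue equation
  in \<open>\<mu>\<close> shows that it solves the equation with right-hand side \<open>2 \<mu> mode \<mu>\<close>.\<close>
definition mode_deriv :: "complex \<Rightarrow> real \<Rightarrow> complex" where
  "mode_deriv \<mu> x = (if \<bar>x\<bar> \<le> 1
     then of_real x * sinh (\<mu> * of_real x) / \<mu>\<^sup>2 - 2 * (cosh (\<mu> * of_real x) - 1) / \<mu> ^ 3
     else (sinh \<mu> / \<mu>\<^sup>2 - 2 * (cosh \<mu> - 1) / \<mu> ^ 3 - (cosh \<mu> - 1) / \<mu>\<^sup>2 * of_real (\<bar>x\<bar> - 1))
       * exp (- \<mu> * of_real (\<bar>x\<bar> - 1)))"

text \<open>Since A = 0 and B = 1, both jump conditions of the eigenvalue equation become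
  \<open>(1 - exp mu) / mu = R\<close>, the characteristic equation.\<close>

lemma jump_sol_mode:
  assumes "\<mu> \<noteq> 0"
  shows "jump_sol (\<mu>\<^sup>2) (\<lambda>_. 0) (mode \<mu>) 0 1 ((1 - exp \<mu>) / \<mu>) ((1 - exp \<mu>) / \<mu>)"
proof -
  let ?k = "(cosh \<mu> - 1) / \<mu>\<^sup>2"
  have "jump_sol (\<mu>\<^sup>2) (\<lambda>_. 0) (\<lambda>x. if \<bar>x\<bar> \<le> 1 then (\<lambda>x. (cosh (\<mu> * of_real x) - 1) / \<mu>\<^sup>2) x
       else (\<lambda>x. ?k * exp (- \<mu> * of_real (x - 1))) \<bar>x\<bar>) 0 (cosh (\<mu> * of_real 0))
       (- \<mu> * ?k * exp (- \<mu> * of_real (1 - 1)) - sinh (\<mu> * of_real 1) / \<mu>)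
       (- \<mu> * ?k * exp (- \<mu> * of_real (1 - 1)) - sinh (\<mu> * of_real 1) / \<mu>)"
  proof (rule jump_sol_even_glue[where ?\<phi>1.0 = "\<lambda>x. sinh (\<mu> * of_real x) / \<mu>" and ?\<phi>2.0 = "\<lambda>x. cosh (\<mu> * of_real x)"
        and ?\<psi>1.0 = "\<lambda>x. - \<mu> * ?k * exp (- \<mu> * of_real (x - 1))"
        and ?\<psi>2.0 = "\<lambda>x. \<mu>\<^sup>2 * ?k * exp (- \<mu> * of_real (x - 1))"])
    fix x :: real
    show "((\<lambda>x. (cosh (\<mu> * of_real x) - 1) / \<mu>\<^sup>2) has_vector_derivative sinh (\<mu> * of_real x) / \<mu>) (at x)"
      "((\<lambda>x. sinh (\<mu> * of_real x) / \<mu>) has_vector_derivative cosh (\<mu> * of_real x)) (at x)"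
      "((\<lambda>x. ?k * exp (- \<mu> * of_real (x - 1))) has_vector_derivative - \<mu> * ?k * exp (- \<mu> * of_real (x - 1))) (at x)"
      "((\<lambda>x. - \<mu> * ?k * exp (- \<mu> * of_real (x - 1))) has_vector_derivative \<mu>\<^sup>2 * ?k * exp (- \<mu> * of_real (x - 1))) (at x)"
      unfolding of_real_diff
      by (rule has_vector_derivative_real_field; use assms in \<open>auto intro!: derivative_eq_intros simp: power2_eq_square field_simps\<close>)+
  qed (use assms in \<open>auto simp: field_simps\<close>)
  moreover have "- \<mu> * ?k * exp (- \<mu> * of_real (1 - 1)) - sinh (\<mu> * of_real 1) / \<mu> = (1 - exp \<mu>) / \<mu>"
    using assms by (simp add: power2_eq_square field_simps flip: cosh_plus_sinh)
  ultimately show ?thesis by (simp add: mode_def[abs_def])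
qed

text \<open>The jumps are the mu-derivative of \<open>(1 - exp mu) / mu\<close>. The datum B is 0
  because the normalisation \<open>g''(0) = 1\<close> of \<open>mode\<close> does not depend on
  mu.\<close>

lemma jump_sol_mode_deriv:
  assumes "\<mu> \<noteq> 0"
  shows "jump_sol (\<mu>\<^sup>2) (\<lambda>x. 2 * \<mu> * mode \<mu> x) (mode_deriv \<mu>) 0 0
    ((- exp \<mu> * \<mu> - (1 - exp \<mu>)) / \<mu>\<^sup>2) ((- exp \<mu> * \<mu> - (1 - exp \<mu>)) / \<mu>\<^sup>2)"
proof -
  let ?k = "(cosh \<mu> - 1) / \<mu>\<^sup>2" and ?k' = "sinh \<mu> / \<mu>\<^sup>2 - 2 * (cosh \<mu> - 1) / \<mu> ^ 3"
  let ?e = "\<lambda>x::real. exp (- \<mu> * of_real (x - 1))"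
  let ?\<psi>1 = "\<lambda>x. (- \<mu> * (?k' - ?k * of_real (x - 1)) - ?k) * ?e x"
  let ?\<psi>2 = "\<lambda>x. (\<mu>\<^sup>2 * (?k' - ?k * of_real (x - 1)) + 2 * \<mu> * ?k) * ?e x"
  let ?\<phi>1 = "\<lambda>x::real. of_real x * cosh (\<mu> * of_real x) / \<mu> - sinh (\<mu> * of_real x) / \<mu>\<^sup>2"
  let ?\<phi>2 = "\<lambda>x::real. of_real x * sinh (\<mu> * of_real x)"
  have "jump_sol (\<mu>\<^sup>2) (\<lambda>x. 2 * \<mu> * mode \<mu> x) (\<lambda>x. if \<bar>x\<bar> \<le> 1
       then (\<lambda>x. of_real x * sinh (\<mu> * of_real x) / \<mu>\<^sup>2 - 2 * (cosh (\<mu> * of_real x) - 1) / \<mu> ^ 3) x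
       else (\<lambda>x. (?k' - ?k * of_real (x - 1)) * ?e x) \<bar>x\<bar>) 0 (?\<phi>2 0) (?\<psi>1 1 - ?\<phi>1 1) (?\<psi>1 1 - ?\<phi>1 1)"
  proof (rule jump_sol_even_glue[where ?\<phi>1.0 = ?\<phi>1 and ?\<phi>2.0 = ?\<phi>2 and ?\<psi>1.0 = ?\<psi>1 and ?\<psi>2.0 = ?\<psi>2])
    fix x :: real
    show "((\<lambda>x. of_real x * sinh (\<mu> * of_real x) / \<mu>\<^sup>2 - 2 * (cosh (\<mu> * of_real x) - 1) / \<mu> ^ 3)
        has_vector_derivative ?\<phi>1 x) (at x)"
      "(?\<phi>1 has_vector_derivative ?\<phi>2 x) (at x)"
      "((\<lambda>x. (?k' - ?k * of_real (x - 1)) * ?e x) has_vector_derivative ?\<psi>1 x) (at x)"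
      "(?\<psi>1 has_vector_derivative ?\<psi>2 x) (at x)"
      unfolding of_real_diff
      by (rule has_vector_derivative_real_field; use assms in
          \<open>auto intro!: derivative_eq_intros simp: power2_eq_square power3_eq_cube field_simps\<close>)+
    show "\<bar>x\<bar> < 1 \<Longrightarrow> ?\<phi>2 x - ?\<phi>2 0 - \<mu>\<^sup>2 * (of_real x * sinh (\<mu> * of_real x) / \<mu>\<^sup>2 - 2 * (cosh (\<mu> * of_real x) - 1) / \<mu> ^ 3)
        = 2 * \<mu> * mode \<mu> x"
      using assms by (simp add: mode_def power2_eq_square power3_eq_cube field_simps)
    show "x > 1 \<Longrightarrow> ?\<psi>2 x - \<mu>\<^sup>2 * ((?k' - ?k * of_real (x - 1)) * ?e x) = 2 * \<mu> * mode \<mu> x"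
      by (simp add: mode_def algebra_simps)
  qed (auto simp: mode_def)
  moreover have "?\<psi>1 1 - ?\<phi>1 1 = (- exp \<mu> * \<mu> - (1 - exp \<mu>)) / \<mu>\<^sup>2"
    using assms by (simp add: power2_eq_square power3_eq_cube field_simps flip: cosh_plus_sinh)
  ultimately show ?thesis by (simp add: mode_deriv_def[abs_def])
qed

lemma bounded_mode:
  assumes "Re \<mu> > 0"
  shows "bounded (range (mode \<mu>))"
proof -
  have "\<mu> \<noteq> 0" using assms by auto
  have "bounded (range (\<lambda>x. if \<bar>x\<bar> \<le> 1 then (\<lambda>x. (cosh (\<mu> * of_real x) - 1) / \<mu>\<^sup>2) x
     else (\<lambda>x. (cosh \<mu> - 1) / \<mu>\<^sup>2 * exp (- \<mu> * of_real (x - 1))) \<bar>x\<bar>))"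
  proof (rule bounded_even_glue)
    fix x :: real assume "x > 1"
    then have "norm (exp (- \<mu> * of_real (x - 1))) \<le> 1" using assms by (simp add: norm_exp_eq_Re)
    then show "norm ((cosh \<mu> - 1) / \<mu>\<^sup>2 * exp (- \<mu> * of_real (x - 1))) \<le> norm ((cosh \<mu> - 1) / \<mu>\<^sup>2) * 1"
      unfolding norm_mult by (intro mult_left_mono) auto
  qed (use \<open>\<mu> \<noteq> 0\<close> in \<open>auto intro!: continuous_intros simp: cosh_def\<close>)
  then show ?thesis by (simp add: mode_def[abs_def])
qed

lemma bounded_mode_deriv:
  assumes "Re \<mu> > 0"
  shows "bounded (range (mode_deriv \<mu>))"
proof -
  have "\<mu> \<noteq> 0" using assms by auto
  let ?k = "(cosh \<mu> - 1) / \<mu>\<^sup>2" and ?k' = "sinh \<mu> / \<mu>\<^sup>2 - 2 * (cosh \<mu> - 1) / \<mu> ^ 3"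
  have "bounded (range (\<lambda>x. if \<bar>x\<bar> \<le> 1
     then (\<lambda>x. of_real x * sinh (\<mu> * of_real x) / \<mu>\<^sup>2 - 2 * (cosh (\<mu> * of_real x) - 1) / \<mu> ^ 3) x
     else (\<lambda>x. (?k' - ?k * of_real (x - 1)) * exp (- \<mu> * of_real (x - 1))) \<bar>x\<bar>))"
  proof (rule bounded_even_glue)
    fix x :: real assume "x > 1"
    define t where "t = x - 1"
    have t: "t > 0" using \<open>x > 1\<close> by (simp add: t_def)
    have tri: "norm (k' - k * of_real t) \<le> norm k' + norm k * t" for k k' :: complex
      using norm_triangle_ineq4[of k' "k * of_real t"] t by (simp add: norm_mult)
    have n: "norm (exp (- \<mu> * of_real t)) = exp (- (Re \<mu> * t))" by (simp add: norm_exp_eq_Re)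
    \<comment> \<open>The linear factor in t is absorbed by the decay:
      \<open>t exp (- c t) <= 1 / c\<close> with \<open>c = Re mu\<close>.\<close>
    have "Re \<mu> * t < exp (Re \<mu> * t)" using exp_ge_add_one_self[of "Re \<mu> * t"] by linarith
    then have te: "t * exp (- (Re \<mu> * t)) \<le> 1 / Re \<mu>"
      using assms by (simp add: exp_minus field_simps)
    have "norm ((?k' - ?k * of_real t) * exp (- \<mu> * of_real t)) \<le> (norm ?k' + norm ?k * t) * exp (- (Re \<mu> * t))"
      unfolding norm_mult n by (intro mult_right_mono tri) auto
    also have "\<dots> = norm ?k' * exp (- (Re \<mu> * t)) + norm ?k * (t * exp (- (Re \<mu> * t)))"
      by (simp add: algebra_simps)
    also have "\<dots> \<le> norm ?k' * 1 + norm ?k * (1 / Re \<mu>)"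
      using te assms t by (intro add_mono mult_left_mono) auto
    finally show "norm ((?k' - ?k * of_real (x - 1)) * exp (- \<mu> * of_real (x - 1))) \<le> norm ?k' * 1 + norm ?k * (1 / Re \<mu>)"
      unfolding t_def .
  qed (use \<open>\<mu> \<noteq> 0\<close> in \<open>auto intro!: continuous_intros simp: cosh_def sinh_def\<close>)
  then show ?thesis by (simp add: mode_deriv_def[abs_def])
qed

section \<open>Eigenfunctions and simplicity in terms of characteristic roots\<close>

lemma exp_neq_1_of_Re_pos:
  assumes "Re \<mu> > 0"
  shows "exp \<mu> \<noteq> (1 :: complex)"
proof
  assume "exp \<mu> = 1"
  then have "exp (Re \<mu>) = 1" by (metis norm_exp_eq_Re norm_one)
  then show False using assms by simp
qed

lemma bounded_range_lincomb:
  fixes g h :: "real \<Rightarrow> complex"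
  assumes "bounded (range g)" "bounded (range h)"
  shows "bounded (range (\<lambda>x. g x + k * h x))"
proof -
  obtain M N where "\<And>x. norm (g x) \<le> M" "\<And>x. norm (h x) \<le> N"
    using assms unfolding bounded_iff by blast
  then have "norm (g x + k * h x) \<le> M + norm k * N" for x
    by (intro norm_triangle_mono) (auto simp: norm_mult intro: mult_left_mono)
  then show ?thesis unfolding bounded_iff by blast
qed

text \<open>The difference of the jump conditions gives \<open>A (exp mu - 1) = 0\<close>, so A = 0.
  Then \<open>g - B mode\<close> has zero data and vanishes; B is nonzero because g is, and the
  remaining jump condition can be divided by B.\<close>

lemma L1_eigenfunD:
  assumes eig: "L1_eigenfun R (\<mu>\<^sup>2) g" and \<mu>: "Re \<mu> > 0"
  shows "1 - exp \<mu> = of_real R * \<mu>" and "\<exists>B. B \<noteq> 0 \<and> g = (\<lambda>x. B * mode \<mu> x)"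
proof -
  have "\<mu> \<noteq> 0" using \<mu> by auto
  obtain A B where sol: "jump_sol (\<mu>\<^sup>2) (\<lambda>_. 0) g A B (A + of_real R * B) (- A + of_real R * B)"
    and bd: "bounded (range g)" and nz: "g \<noteq> (\<lambda>_. 0)"
    using eig unfolding L1_eigenfun_def L1_eq_iff_jump_sol by blast
  note J = bounded_jump_sol_jumps[OF sol bd \<mu>]
  have "2 * (A * (exp \<mu> - 1)) = (A * exp \<mu> + B * ((1 - exp \<mu>) / \<mu>)) - (- A * exp \<mu> + B * ((1 - exp \<mu>) / \<mu>)) - 2 * A"
    by (simp add: algebra_simps)
  also have "\<dots> = 0" unfolding J[symmetric] by simp
  finally have A: "A = 0" using exp_neq_1_of_Re_pos[OF \<mu>] by simp
  have bd': "bounded (range (\<lambda>x. g x + (- B) * mode \<mu> x))"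
    by (rule bounded_range_lincomb[OF bd bounded_mode[OF \<mu>]])
  have "(\<lambda>x. g x + (- B) * mode \<mu> x) = (\<lambda>_. 0)"
    using bounded_jump_sol_trivial[of \<mu> "\<lambda>x. g x + (- B) * mode \<mu> x"]
      jump_sol_lincomb[OF sol jump_sol_mode[OF \<open>\<mu> \<noteq> 0\<close>], of "- B"] bd' \<mu> A by simp
  then have g: "g = (\<lambda>x. B * mode \<mu> x)" by (simp add: fun_eq_iff)
  with nz have B: "B \<noteq> 0" by auto
  show "\<exists>B. B \<noteq> 0 \<and> g = (\<lambda>x. B * mode \<mu> x)" using g B by blast
  show "1 - exp \<mu> = of_real R * \<mu>"
  proof -
    have "B * of_real R = B * ((1 - exp \<mu>) / \<mu>)" using J(1) A by (simp add: mult.commute)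
    then have "of_real R = (1 - exp \<mu>) / \<mu>" using B by (simp only: mult_cancel_left) simp
    then show ?thesis using \<open>\<mu> \<noteq> 0\<close> by simp
  qed
qed

lemma L1_eigenfun_mode:
  assumes \<mu>: "Re \<mu> > 0" and char: "1 - exp \<mu> = of_real R * \<mu>"
  shows "L1_eigenfun R (\<mu>\<^sup>2) (mode \<mu>)"
proof -
  have "\<mu> \<noteq> 0" using \<mu> by auto
  then have "(1 - exp \<mu>) / \<mu> = of_real R" using char by simp
  with jump_sol_mode[OF \<open>\<mu> \<noteq> 0\<close>]
  have sol: "jump_sol (\<mu>\<^sup>2) (\<lambda>_. 0) (mode \<mu>) 0 1 (of_real R) (of_real R)" by simp
  have "mode \<mu> \<noteq> (\<lambda>_. 0)"
  proof
    assume "mode \<mu> = (\<lambda>_. 0)"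
    with sol jump_sol_zero_imp show False by fastforce
  qed
  moreover have "L1_eq R (\<mu>\<^sup>2) (\<lambda>_. 0) (mode \<mu>)"
    unfolding L1_eq_iff_jump_sol by (rule exI[of _ 0], rule exI[of _ 1]) (use sol in simp)
  ultimately show ?thesis using bounded_mode[OF \<mu>] by (simp add: L1_eigenfun_def)
qed

text \<open>The multiplicity condition is that \<open>\<mu>\<close> is a simple root of \<open>exp \<mu> - 1 + R \<mu>\<close>.\<close>
lemma L1_simple_eigenvalue_square:
  assumes \<mu>: "Re \<mu> > 0" and char: "1 - exp \<mu> = of_real R * \<mu>" and simple_root: "exp \<mu> + of_real R \<noteq> 0"
  shows "L1_simple_eigenvalue R (\<mu>\<^sup>2)"
  unfolding L1_simple_eigenvalue_def
proof (intro conjI allI impI)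
  show "L1_eigenvalue R (\<mu>\<^sup>2)"
    using L1_eigenfun_mode[OF \<mu> char] unfolding L1_eigenvalue_def by blast
next
  fix g h assume "L1_eigenfun R (\<mu>\<^sup>2) g \<and> L1_eigenfun R (\<mu>\<^sup>2) h"
  then obtain B C where "B \<noteq> 0" "g = (\<lambda>x. B * mode \<mu> x)" "h = (\<lambda>x. C * mode \<mu> x)"
    using L1_eigenfunD(2)[OF _ \<mu>] by metis
  then show "\<exists>c. h = (\<lambda>x. c * g x)" by (intro exI[of _ "C / B"]) auto
next
  fix g assume "L1_eigenfun R (\<mu>\<^sup>2) g"
  then obtain B where B: "B \<noteq> 0" and g: "g = (\<lambda>x. B * mode \<mu> x)"
    using L1_eigenfunD(2)[OF _ \<mu>] by blast
  have "\<mu> \<noteq> 0" using \<mu> by auto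
  show "\<not> (\<exists>h. L1_eq R (\<mu>\<^sup>2) g h \<and> bounded (range h))"
  proof
    assume "\<exists>h. L1_eq R (\<mu>\<^sup>2) g h \<and> bounded (range h)"
    then obtain h A D where sol: "jump_sol (\<mu>\<^sup>2) g h A D (A + of_real R * D) (- A + of_real R * D)"
      and bd: "bounded (range h)" unfolding L1_eq_iff_jump_sol by blast
    \<comment> \<open>Chosen so that adding \<open>k * mode_deriv\<close> to h cancels the
      right-hand side \<open>g = B mode\<close>.\<close>
    define k where "k = - B / (2 * \<mu>)"
    define K where "K = (- exp \<mu> * \<mu> - (1 - exp \<mu>)) / \<mu>\<^sup>2"
    have f: "g x + k * (2 * \<mu> * mode \<mu> x) = 0" for x
      using \<open>\<mu> \<noteq> 0\<close> by (simp add: g k_def)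
    have sol': "jump_sol (\<mu>\<^sup>2) (\<lambda>_. 0) (\<lambda>x. h x + k * mode_deriv \<mu> x) A D
        (A + of_real R * D + k * K) (- A + of_real R * D + k * K)"
      using jump_sol_lincomb[OF sol jump_sol_mode_deriv[OF \<open>\<mu> \<noteq> 0\<close>], of k] unfolding f K_def by simp
    have bd': "bounded (range (\<lambda>x. h x + k * mode_deriv \<mu> x))"
      by (rule bounded_range_lincomb[OF bd bounded_mode_deriv[OF \<mu>]])
    note J = bounded_jump_sol_jumps[OF sol' bd' \<mu>]
    have c: "(1 - exp \<mu>) / \<mu> = of_real R" using char \<open>\<mu> \<noteq> 0\<close> by simp
    \<comment> \<open>Adding the jump conditions removes A, and the characteristic equation removes
      D, leaving \<open>k K = 0\<close>.\<close>
    have "2 * (k * K) = (A + of_real R * D + k * K) + (- A + of_real R * D + k * K) - 2 * (D * of_real R)"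
      by (simp add: algebra_simps)
    also have "\<dots> = 0" unfolding J c by simp
    finally have "k * K = 0" by simp
    moreover have "k \<noteq> 0" using B \<open>\<mu> \<noteq> 0\<close> by (simp add: k_def)
    \<comment> \<open>\<open>K\<close> is the derivative of \<open>(1 - exp mu) / mu\<close>; here
      the simplicity of the root enters.\<close>
    moreover have "K = - (exp \<mu> + of_real R) / \<mu>"
      unfolding K_def char using \<open>\<mu> \<noteq> 0\<close> by (simp add: power2_eq_square field_simps)
    then have "K \<noteq> 0"
      using simple_root \<open>\<mu> \<noteq> 0\<close> by (metis divide_eq_0_iff neg_equal_0_iff_equal)
    ultimately show False by simp
  qed
qed

text \<open>The eigenfunction is x truncated to [-1, 1], which is minus the equilibrium
  \<open>w^1\<close>. It has \<open>g''(0) = 0\<close>, so R drops out of its jump conditions. This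
  is the endpoint of the real branch at R = -1.\<close>

lemma L1_eigenvalue_zero: "L1_eigenvalue R 0"
proof -
  define g :: "real \<Rightarrow> complex" where "g x = of_real (max (-1) (min 1 x))" for x
  let ?g1 = "\<lambda>x::real. if \<bar>x\<bar> < 1 then 1 else 0 :: complex"
  have "jump_sol 0 (\<lambda>_. 0) g 1 0 1 (-1)"
  proof (rule jump_solI[where ?g1.0 = ?g1 and ?g2.0 = "\<lambda>_. 0" and a = 0 and b = 1 and c = 1 and d = 0])
    show "continuous_on UNIV g" unfolding g_def by (intro continuous_intros)
    fix x :: real assume x: "x \<noteq> -1" "x \<noteq> 1"
    consider "x \<in> {-1<..<1}" | "x \<in> {1<..}" | "x \<in> {..< -1}" using x by force
    then have "(g has_vector_derivative ?g1 x) (at x) \<and> (?g1 has_vector_derivative 0) (at x)"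
    proof cases
      case 1
      have "((\<lambda>x. of_real x) has_vector_derivative (1::complex)) (at x)"
        by (auto intro!: derivative_eq_intros)
      then have "(g has_vector_derivative 1) (at x)"
        by (rule has_vector_derivative_transform_within_open[OF _ _ 1]) (auto simp: g_def)
      moreover have "(?g1 has_vector_derivative 0) (at x)"
        by (rule has_vector_derivative_transform_within_open[OF has_vector_derivative_const[of 1] _ 1]) auto
      ultimately show ?thesis using 1 by auto
    next
      case 2
      have "(g has_vector_derivative 0) (at x)"
        by (rule has_vector_derivative_transform_within_open[OF has_vector_derivative_const[of 1] _ 2]) (auto simp: g_def)
      moreover have "(?g1 has_vector_derivative 0) (at x)"
        by (rule has_vector_derivative_transform_within_open[OF has_vector_derivative_const[of 0] _ 2]) auto
      ultimately show ?thesis using 2 by auto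
    next
      case 3
      have "(g has_vector_derivative 0) (at x)"
        by (rule has_vector_derivative_transform_within_open[OF has_vector_derivative_const[of "-1"] _ 3]) (auto simp: g_def)
      moreover have "(?g1 has_vector_derivative 0) (at x)"
        by (rule has_vector_derivative_transform_within_open[OF has_vector_derivative_const[of 0] _ 3]) auto
      ultimately show ?thesis using 3 by auto
    qed
    then show "(g has_vector_derivative ?g1 x) (at x)" "(?g1 has_vector_derivative 0) (at x)" by auto
  next
    show "(?g1 \<longlongrightarrow> 0) (at_left (-1))"
      by (rule tendsto_eventually, rule eventually_at_leftI[of "-2"]) auto
    show "(?g1 \<longlongrightarrow> 1) (at_right (-1))"
      by (rule tendsto_eventually, rule eventually_at_rightI[of _ 1]) auto
    show "(?g1 \<longlongrightarrow> 1) (at_left 1)"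
      by (rule tendsto_eventually, rule eventually_at_leftI[of "-1"]) auto
    show "(?g1 \<longlongrightarrow> 0) (at_right 1)"
      by (rule tendsto_eventually, rule eventually_at_rightI[of _ 2]) auto
  qed (auto simp: g_def)
  then have "L1_eq R 0 (\<lambda>_. 0) g"
    unfolding L1_eq_iff_jump_sol by (intro exI[of _ 1] exI[of _ 0]) simp
  moreover have "norm (g x) \<le> 1" for x unfolding g_def norm_of_real by (simp add: abs_le_iff)
  then have "bounded (range g)" unfolding bounded_iff by blast
  moreover have "g 1 \<noteq> 0" by (simp add: g_def)
  then have "g \<noteq> (\<lambda>_. 0)" by auto
  ultimately show ?thesis unfolding L1_eigenvalue_def L1_eigenfun_def by blast
qed

section \<open>Location and crossing of the eigenvalues\<close>

lemma L1_no_unstable_eigenvalue: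
  fixes a0 R0 R :: real
  assumes a0: "3.9 < a0" "a0 < 4" "cos a0 - sin a0 = exp (- a0)" "R0 = (1 - exp a0 * cos a0) / a0"
    and R: "-1 \<le> R" "R \<le> R0" and eig: "L1_eigenvalue R lam"
  shows "Re lam \<le> 0"
proof (rule ccontr)
  assume "\<not> Re lam \<le> 0"
  \<comment> \<open>The principal root has \<open>Re mu >= 0\<close>, and \<open>Re lam > 0\<close>
    turns into \<open>b^2 < a^2\<close>, which makes \<open>Re mu\<close> positive.\<close>
  define \<mu> where "\<mu> = csqrt lam"
  have lam: "lam = \<mu>\<^sup>2" by (simp add: \<mu>_def)
  define a b where "a = Re \<mu>" and "b = Im \<mu>"
  have "a \<ge> 0" unfolding a_def \<mu>_def by (rule Re_csqrt)
  have "b\<^sup>2 < a\<^sup>2" using \<open>\<not> Re lam \<le> 0\<close> by (simp add: lam a_def b_def power2_eq_square)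
  then have ba: "\<bar>b\<bar> < a" using \<open>a \<ge> 0\<close> power2_less_imp_less[of "\<bar>b\<bar>" a] by simp
  then have "Re \<mu> > 0" by (simp add: a_def)
  obtain g where "L1_eigenfun R (\<mu>\<^sup>2) g" using eig unfolding L1_eigenvalue_def lam by blast
  from L1_eigenfunD(1)[OF this \<open>Re \<mu> > 0\<close>] have char: "exp \<mu> = 1 - of_real R * \<mu>" by (simp add: algebra_simps)
  have "Re (exp \<mu>) = 1 - R * a" "Im (exp \<mu>) = - R * b" unfolding char by (simp_all add: a_def b_def)
  then have e: "exp a * cos b = 1 - R * a" "exp a * sin b = - R * b"
    by (simp_all add: Re_exp Im_exp a_def b_def)
  \<comment> \<open>Roots come in conjugate pairs, so b may be replaced by its absolute
    value.\<close>
  have "exp a * cos \<bar>b\<bar> = 1 - R * a" "exp a * sin \<bar>b\<bar> = - R * \<bar>b\<bar>"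
    using e by (auto simp: abs_if)
  then show False by (rule no_char_root[OF a0 R _ ba, rotated]) simp
qed

text \<open>With r = -R, the positive root s of \<open>exp s - 1 = r s\<close> gives the eigenvalue
  \<open>s^2\<close>. Continuity follows because s is Lipschitz in R with constant 2.\<close>

lemma positive_eigenvalue_branch:
  "\<exists>\<mu> :: real \<Rightarrow> real. continuous_on {..-1} \<mu> \<and> \<mu> (-1) = 0 \<and>
     (\<forall>R \<le> -1. L1_eigenvalue R (complex_of_real (\<mu> R))) \<and> (\<forall>R < -1. \<mu> R > 0)"
proof -
  have "\<forall>r::real. \<exists>x::real. 1 < r \<longrightarrow> x > 0 \<and> exp x - 1 = r * x"
    using expm1_eq_linear_root by blast
  from choice[OF this] obtain s :: "real \<Rightarrow> real"
    where s': "\<forall>r. 1 < r \<longrightarrow> s r > 0 \<and> exp (s r) - 1 = r * s r" ..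
  then have s: "\<And>r. 1 < r \<Longrightarrow> s r > 0" "\<And>r. 1 < r \<Longrightarrow> exp (s r) - 1 = r * s r" by simp_all
  \<comment> \<open>The chosen root \<open>s\<close> is unspecified at r = 1, so the endpoint value
    is set to 0.\<close>
  define \<sigma> where "\<sigma> R = (if R = -1 then 0 else s (- R))" for R
  have lip: "\<bar>\<sigma> S - \<sigma> R\<bar> \<le> 2 * \<bar>S - R\<bar>" if "R \<le> -1" "S \<le> -1" for R S
  proof -
    have slope: "(exp (s r) - 1) / s r = r" if "r > 1" for r
      unfolding s(2)[OF that] using s(1)[OF that] by simp
    \<comment> \<open>Comparison with the endpoint, where the slope lemma does not apply since the
      root is 0; \<open>exp s > 1 + s + s^2 / 2\<close> gives \<open>s / 2 < r - 1\<close>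
      instead.\<close>
    have away: "\<sigma> S \<le> 2 * (- 1 - S)" "\<sigma> S \<ge> 0" if "S \<le> -1" for S
    proof -
      have "s r \<le> 2 * (r - 1)" if "r > 1" for r
      proof -
        have "1 + s r + (s r)\<^sup>2 / 2 < 1 + r * s r" using exp_gt_quadratic[OF s(1)[OF that]] s(2)[OF that] by linarith
        then have "s r * (1 + s r / 2) < s r * r" by (simp add: power2_eq_square algebra_simps)
        then have "1 + s r / 2 < r" using s(1)[OF that] by simp
        then show ?thesis by simp
      qed
      note near = this
      show "\<sigma> S \<le> 2 * (- 1 - S)"
        using near[of "- S"] that by (cases "S = -1") (auto simp: \<sigma>_def)
      show "\<sigma> S \<ge> 0"
        using less_imp_le[OF s(1)[of "- S"]] that by (cases "S = -1") (auto simp: \<sigma>_def)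
    qed
    have ordered: "\<bar>s r - s q\<bar> \<le> 2 * \<bar>r - q\<bar>" if "r > 1" "q > 1" for r q
    proof (cases "s q \<le> s r")
      case True
      then show ?thesis using expm1_slope_lower[OF s(1)[OF that(2)] True] unfolding slope[OF that(1)] slope[OF that(2)] by (simp add: abs_if)
    next
      case False
      then show ?thesis using expm1_slope_lower[OF s(1)[OF that(1)], of "s q"] unfolding slope[OF that(1)] slope[OF that(2)] by (simp add: abs_if)
    qed
    show ?thesis
    proof (cases "R = -1 \<or> S = -1")
      case True
      moreover have "\<sigma> (-1) = 0" by (simp add: \<sigma>_def)
      ultimately show ?thesis using away[OF that(1)] away[OF that(2)] that by auto
    next
      case False
      then show ?thesis using ordered[of "- S" "- R"] that by (simp add: \<sigma>_def abs_minus_commute[of R])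
    qed
  qed
  have "continuous_on {..-1} \<sigma>"
    unfolding continuous_on_iff
  proof (intro ballI allI impI)
    fix R e :: real assume "R \<in> {..-1}" "0 < e"
    have "dist (\<sigma> S) (\<sigma> R) < e" if "S \<in> {..-1}" "dist S R < e / 2" for S
      using lip[of R S] \<open>R \<in> {..-1}\<close> that by (simp add: dist_real_def)
    then show "\<exists>d>0. \<forall>S\<in>{..-1}. dist S R < d \<longrightarrow> dist (\<sigma> S) (\<sigma> R) < e"
      using \<open>0 < e\<close> by (intro exI[of _ "e / 2"]) simp
  qed
  then have cont: "continuous_on {..-1} (\<lambda>R. (\<sigma> R)\<^sup>2)" by (intro continuous_intros)
  have ev: "L1_eigenvalue R (complex_of_real ((\<sigma> R)\<^sup>2))" if "R \<le> -1" for R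
  proof (cases "R = -1")
    case True then show ?thesis using L1_eigenvalue_zero by (simp add: \<sigma>_def)
  next
    case False
    then have r: "- R > 1" using that by simp
    have "1 - exp (complex_of_real (s (- R))) = of_real (1 - exp (s (- R)))" by (simp add: exp_of_real)
    also have "1 - exp (s (- R)) = R * s (- R)" using s(2)[OF r] by linarith
    finally have "1 - exp (complex_of_real (s (- R))) = of_real R * of_real (s (- R))" by simp
    then have "L1_eigenfun R ((of_real (s (- R)))\<^sup>2) (mode (of_real (s (- R))))"
      using s(1)[OF r] by (intro L1_eigenfun_mode) auto
    then show ?thesis unfolding L1_eigenvalue_def \<sigma>_def of_real_power if_not_P[OF False] by blast
  qed
  have pos: "(\<sigma> R)\<^sup>2 > 0" if "R < -1" for R using s(1)[of "- R"] that by (simp add: \<sigma>_def)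
  have zero: "(\<sigma> (-1))\<^sup>2 = 0" by (simp add: \<sigma>_def)
  show ?thesis
    by (rule exI[of _ "\<lambda>R. (\<sigma> R)\<^sup>2"], intro conjI allI impI cont ev pos zero)
qed

text \<open>Near a simple root the characteristic equation is solved for \<open>\<mu>\<close> by inverting
  \<open>\<mu> \<mapsto> (1 - exp \<mu>) / \<mu>\<close>.\<close>
lemma eigenvalue_curve:
  fixes \<mu>0 :: complex and R0 :: real
  assumes \<mu>0: "Re \<mu>0 > 0" and char: "1 - exp \<mu>0 = of_real R0 * \<mu>0" and simple_root: "exp \<mu>0 + of_real R0 \<noteq> 0"
  shows "\<exists>m :: real \<Rightarrow> complex. \<exists>\<epsilon>>0. m R0 = \<mu>0 \<and>
    (\<forall>R. \<bar>R - R0\<bar> < \<epsilon> \<longrightarrow> Re (m R) > 0 \<and> 1 - exp (m R) = of_real R * m R) \<and>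
    (m has_vector_derivative - \<mu>0 / (exp \<mu>0 + of_real R0)) (at R0)"
proof -
  define F where "F \<mu> = (1 - exp \<mu>) / \<mu>" for \<mu> :: complex
  define S where "S = {\<mu>. Re \<mu> > 0}"
  have "open S" unfolding S_def by (rule open_halfspace_Re_gt)
  have nz: "\<mu> \<noteq> 0" if "\<mu> \<in> S" for \<mu> using that by (auto simp: S_def)
  have "F holomorphic_on S" unfolding F_def using nz by (auto intro!: holomorphic_intros)
  have "\<mu>0 \<in> S" using \<mu>0 by (simp add: S_def)
  have "\<mu>0 \<noteq> 0" using nz[OF \<open>\<mu>0 \<in> S\<close>] .
  have F0: "F \<mu>0 = of_real R0" using char \<open>\<mu>0 \<noteq> 0\<close> by (simp add: F_def)
  have "(F has_field_derivative (- exp \<mu>0 * \<mu>0 - (1 - exp \<mu>0)) / \<mu>0\<^sup>2) (at \<mu>0)"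
    unfolding F_def using \<open>\<mu>0 \<noteq> 0\<close> by (auto intro!: derivative_eq_intros simp: power2_eq_square)
  moreover have "(- exp \<mu>0 * \<mu>0 - (1 - exp \<mu>0)) / \<mu>0\<^sup>2 = - (exp \<mu>0 + of_real R0) / \<mu>0"
    unfolding char using \<open>\<mu>0 \<noteq> 0\<close> by (simp add: power2_eq_square field_simps)
  ultimately have dF: "deriv F \<mu>0 = - (exp \<mu>0 + of_real R0) / \<mu>0" using DERIV_imp_deriv by metis
  then have "deriv F \<mu>0 \<noteq> 0" using simple_root \<open>\<mu>0 \<noteq> 0\<close> by (simp add: add_eq_0_iff)
  obtain r where r: "r > 0" "ball \<mu>0 r \<subseteq> S" "open (F ` ball \<mu>0 r)" "inj_on F (ball \<mu>0 r)"
    using has_complex_derivative_locally_invertible[OF \<open>F holomorphic_on S\<close> \<open>\<mu>0 \<in> S\<close> \<open>open S\<close> \<open>deriv F \<mu>0 \<noteq> 0\<close>] .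
  have holB: "F holomorphic_on ball \<mu>0 r" using \<open>F holomorphic_on S\<close> r(2) holomorphic_on_subset by blast
  \<comment> \<open>The curve is this local inverse of F, restricted to real arguments; its values
    stay in a ball inside the right half plane.\<close>
  obtain G where G: "G holomorphic_on F ` ball \<mu>0 r"
    "\<And>z. z \<in> ball \<mu>0 r \<Longrightarrow> deriv F z * deriv G (F z) = 1" "\<And>z. z \<in> ball \<mu>0 r \<Longrightarrow> G (F z) = z"
    using holomorphic_has_inverse[OF holB open_ball r(4)] by metis
  have c: "\<mu>0 \<in> ball \<mu>0 r" using r(1) by simp
  then have "of_real R0 \<in> F ` ball \<mu>0 r" using F0 by (metis imageI)
  then obtain \<epsilon> where \<epsilon>: "\<epsilon> > 0" "ball (of_real R0) \<epsilon> \<subseteq> F ` ball \<mu>0 r"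
    using r(3) open_contains_ball by metis
  have "Re (G (of_real R)) > 0 \<and> 1 - exp (G (of_real R)) = of_real R * G (of_real R)" if "\<bar>R - R0\<bar> < \<epsilon>" for R
  proof -
    have "dist (complex_of_real R0) (of_real R) < \<epsilon>"
      using that by (simp add: dist_norm norm_of_real abs_minus_commute flip: of_real_diff)
    then obtain z where z: "z \<in> ball \<mu>0 r" "of_real R = F z" using \<epsilon>(2) by (metis imageE mem_ball subsetD)
    then have "G (of_real R) = z" "z \<in> S" using G(3) r(2) by auto
    then show ?thesis using z(2) nz[OF \<open>z \<in> S\<close>] by (simp add: S_def F_def)
  qed
  moreover have "((\<lambda>R. G (of_real R)) has_vector_derivative - \<mu>0 / (exp \<mu>0 + of_real R0)) (at R0)"
  proof (rule has_vector_derivative_real_field)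
    have "deriv G (of_real R0) = - \<mu>0 / w" if "- w / \<mu>0 * deriv G (of_real R0) = 1" "w \<noteq> 0" for w
    proof -
      have "- (w * deriv G (of_real R0)) = \<mu>0" using that(1) \<open>\<mu>0 \<noteq> 0\<close> by (simp add: field_simps)
      then have "\<mu>0 = - (w * deriv G (of_real R0))" by simp
      then show ?thesis using that(2) by simp
    qed
    from this[OF G(2)[OF c, unfolded F0 dF] simple_root]
    have "deriv G (of_real R0) = - \<mu>0 / (exp \<mu>0 + of_real R0)" .
    then show "(G has_field_derivative - \<mu>0 / (exp \<mu>0 + of_real R0)) (at (of_real R0))"
      using holomorphic_derivI[OF G(1) r(3) \<open>of_real R0 \<in> F ` ball \<mu>0 r\<close>] by simp
  qed
  moreover have "G (of_real R0) = \<mu>0" using G(3)[OF c] F0 by simp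
  ultimately show ?thesis using \<epsilon>(1) by (intro exI[of _ "\<lambda>R. G (of_real R)"] exI[of _ \<epsilon>]) auto
qed

theorem theorem1:
  fixes a0 R0 :: real
  assumes a0_range: "3.9 < a0" "a0 < 4"
    and a0_root: "cos a0 - sin a0 = exp (- a0)"
    and R0_def: "R0 = (1 - exp a0 * cos a0) / a0"
  shows
    "(\<forall>R lam. -1 \<le> R \<and> R \<le> R0 \<and> L1_eigenvalue R lam \<longrightarrow> Re lam \<le> 0)
     \<and> (\<exists>\<mu> :: real \<Rightarrow> real. continuous_on {..-1} \<mu> \<and> \<mu> (-1) = 0 \<and>
          (\<forall>R \<le> -1. L1_eigenvalue R (complex_of_real (\<mu> R))) \<and> (\<forall>R < -1. \<mu> R > 0))
     \<and> (\<exists>\<omega>>0. \<exists>lb :: real \<Rightarrow> complex. \<exists>d. \<exists>\<epsilon>>0.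
          lb R0 = \<i> * complex_of_real \<omega> \<and>
          L1_simple_eigenvalue R0 (\<i> * complex_of_real \<omega>) \<and>
          L1_simple_eigenvalue R0 (- \<i> * complex_of_real \<omega>) \<and>
          (\<forall>R. \<bar>R - R0\<bar> < \<epsilon> \<longrightarrow> L1_eigenvalue R (lb R) \<and> L1_eigenvalue R (cnj (lb R))) \<and>
          (lb has_vector_derivative d) (at R0) \<and> Re d > 0)"
proof (intro conjI)
  show "\<forall>R lam. -1 \<le> R \<and> R \<le> R0 \<and> L1_eigenvalue R lam \<longrightarrow> Re lam \<le> 0"
    using L1_no_unstable_eigenvalue[OF a0_range a0_root R0_def] by blast
  show "\<exists>\<mu> :: real \<Rightarrow> real. continuous_on {..-1} \<mu> \<and> \<mu> (-1) = 0 \<and>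
          (\<forall>R \<le> -1. L1_eigenvalue R (complex_of_real (\<mu> R))) \<and> (\<forall>R < -1. \<mu> R > 0)"
    by (rule positive_eigenvalue_branch)
next
  \<comment> \<open>On the diagonal the square is purely imaginary, \<open>mu0^2 = 2 i a0^2\<close>,
    so omega is \<open>2 * a0^2\<close>.\<close>
  define \<mu>0 where "\<mu>0 = Complex a0 a0"
  have "a0 > 0" using a0_range by simp
  have co: "exp a0 * cos a0 = 1 - R0 * a0" using \<open>a0 > 0\<close> R0_def by (simp add: field_simps)
  have "exp a0 * (cos a0 - sin a0) = 1" unfolding a0_root by (simp add: exp_minus)
  then have si: "exp a0 * sin a0 = - R0 * a0" using co by (simp add: algebra_simps)
  \<comment> \<open>The bounds pi < 3.9 < a0 < 4 < 2 pi make sin negative, and the imaginary part of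
    the characteristic equation then yields \<open>R0 > 0\<close>.\<close>
  have "sin a0 < 0" using pi_less_39 a0_range pi_gt3 by (intro sin_lt_zero) auto
  then have "exp a0 * sin a0 < 0" by (simp add: mult_less_0_iff)
  then have "R0 * a0 > 0" using si by simp
  have e: "exp \<mu>0 = 1 - of_real R0 * \<mu>0"
    using co si by (simp add: complex_eq_iff Re_exp Im_exp \<mu>0_def)
  have pos: "Re \<mu>0 > 0" "Re (cnj \<mu>0) > 0" using \<open>a0 > 0\<close> by (simp_all add: \<mu>0_def)
  have char: "1 - exp \<mu>0 = of_real R0 * \<mu>0" using e by simp
  define w where "w = exp \<mu>0 + of_real R0"
  \<comment> \<open>This one sign yields both the simplicity of the root and the direction of the
    crossing.\<close>
  have "Im w = - (R0 * a0)" unfolding w_def e by (simp add: \<mu>0_def)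
  then have "w \<noteq> 0" using \<open>R0 * a0 > 0\<close> by auto
  have char': "1 - exp (cnj \<mu>0) = of_real R0 * cnj \<mu>0" "exp (cnj \<mu>0) + of_real R0 \<noteq> 0"
  proof -
    show "1 - exp (cnj \<mu>0) = of_real R0 * cnj \<mu>0"
      using arg_cong[OF char, of cnj] by (simp add: exp_cnj)
    have "exp (cnj \<mu>0) + of_real R0 = cnj w" by (simp add: w_def exp_cnj)
    then show "exp (cnj \<mu>0) + of_real R0 \<noteq> 0" using \<open>w \<noteq> 0\<close> by simp
  qed
  have sq: "\<mu>0\<^sup>2 = \<i> * complex_of_real (2 * a0\<^sup>2)" "(cnj \<mu>0)\<^sup>2 = - \<i> * complex_of_real (2 * a0\<^sup>2)"
    by (simp_all add: \<mu>0_def complex_eq_iff power2_eq_square)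
  obtain m \<epsilon> where m: "\<epsilon> > 0" "m R0 = \<mu>0"
    "\<And>R. \<bar>R - R0\<bar> < \<epsilon> \<Longrightarrow> Re (m R) > 0 \<and> 1 - exp (m R) = of_real R * m R"
    "(m has_vector_derivative - \<mu>0 / w) (at R0)"
    using eigenvalue_curve[OF pos(1) char] \<open>w \<noteq> 0\<close> unfolding w_def by blast
  define lb where "lb R = (m R)\<^sup>2" for R
  have ev: "L1_eigenvalue R (lb R) \<and> L1_eigenvalue R (cnj (lb R))" if "\<bar>R - R0\<bar> < \<epsilon>" for R
  proof -
    have p: "Re (m R) > 0" "Re (cnj (m R)) > 0" and c: "1 - exp (m R) = of_real R * m R" using m(3)[OF that] by auto
    have c': "1 - exp (cnj (m R)) = of_real R * cnj (m R)" using arg_cong[OF c, of cnj] by (simp add: exp_cnj)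
    show ?thesis
      using L1_eigenfun_mode[OF p(1) c] L1_eigenfun_mode[OF p(2) c'] unfolding L1_eigenvalue_def lb_def by auto
  qed
  have "((\<lambda>R. m R * m R) has_vector_derivative m R0 * (- \<mu>0 / w) + (- \<mu>0 / w) * m R0) (at R0)"
    by (rule has_vector_derivative_mult[OF m(4) m(4)])
  then have der: "(lb has_vector_derivative - 2 * \<mu>0\<^sup>2 / w) (at R0)"
    unfolding m(2) lb_def[abs_def] by (simp add: power2_eq_square)
  \<comment> \<open>Writing \<open>1 / w\<close> as \<open>cnj w / |w|^2\<close> and using
    \<open>Re (i cnj w) = Im w\<close> reduces the crossing speed to a positive multiple of
    \<open>- Im w = R0 a0\<close>.\<close>
  have "- 2 * \<mu>0\<^sup>2 / w = of_real (- (4 * a0\<^sup>2) / (norm w)\<^sup>2) * (\<i> * cnj w)"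
    unfolding sq complex_div_cnj[of _ w] by (simp add: mult_ac)
  then have "Re (- 2 * \<mu>0\<^sup>2 / w) = - (4 * a0\<^sup>2) / (norm w)\<^sup>2 * Im w"
    by (simp only: Re_complex_of_real Im_complex_of_real times_complex.sel) simp
  also have "\<dots> = 4 * a0\<^sup>2 * (R0 * a0) / (norm w)\<^sup>2" unfolding \<open>Im w = - (R0 * a0)\<close> by simp
  also have "\<dots> > 0" using zero_less_mult_pos2[OF \<open>R0 * a0 > 0\<close> \<open>a0 > 0\<close>] \<open>a0 > 0\<close> \<open>w \<noteq> 0\<close> by (intro divide_pos_pos mult_pos_pos) auto
  finally have "Re (- 2 * \<mu>0\<^sup>2 / w) > 0" .
  moreover have "L1_simple_eigenvalue R0 (\<i> * complex_of_real (2 * a0\<^sup>2))"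
    using L1_simple_eigenvalue_square[OF pos(1) char] \<open>w \<noteq> 0\<close> unfolding sq w_def by blast
  moreover have "L1_simple_eigenvalue R0 (- \<i> * complex_of_real (2 * a0\<^sup>2))"
    using L1_simple_eigenvalue_square[OF pos(2) char'] unfolding sq .
  moreover have "lb R0 = \<i> * complex_of_real (2 * a0\<^sup>2)" unfolding lb_def m(2) sq ..
  moreover have "2 * a0\<^sup>2 > 0" using \<open>a0 > 0\<close> by simp
  ultimately show "\<exists>\<omega>>0. \<exists>lb :: real \<Rightarrow> complex. \<exists>d. \<exists>\<epsilon>>0.
          lb R0 = \<i> * complex_of_real \<omega> \<and>
          L1_simple_eigenvalue R0 (\<i> * complex_of_real \<omega>) \<and>
          L1_simple_eigenvalue R0 (- \<i> * complex_of_real \<omega>) \<and>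
          (\<forall>R. \<bar>R - R0\<bar> < \<epsilon> \<longrightarrow> L1_eigenvalue R (lb R) \<and> L1_eigenvalue R (cnj (lb R))) \<and>
          (lb has_vector_derivative d) (at R0) \<and> Re d > 0"
    using m(1) ev der by blast
qed

end
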